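(* Let $G=(V,E)$ be a polytree, and let $I_G\subseteq\mathbb{C}[s_{ij},t_{ijk}\mid 1\le i\le j\le k\le n]$ be the ideal generated by the $2$-minors of all trek-matrices $A_{i,j}$ (for all $i,j\in V$ such that there is a 2-trek between $i$ and $j$) together with the linear generators $s_{ij}$, whenever there is no 2-trek between $i,j$, and $t_{ijk}$, whenever there is no 3-trek between $i,j,k$. Then all binomials in $\mathcal{I}^{\leq 3}(G)$ are generated by these linear and quadratic generators, i.e. $$\mathcal{I}^{\leq 3}(G)=I_G.$$
   Context: A polytree is a finite directed acyclic graph $G=(V,E)$, $V=\{1,\dots,n\}$, whose underlying undirected graph is a tree. $\mathbb{R}^E$ denotes the set of real $V\times V$ matrices $\Lambda=(\lambda_{ij})$ with $\lambda_{ij}=0$ whenever $i\to j\notin E$. $PD(V)$ is the cone of positive definite symmetric matrices in $\mathbb{R}^{V\times V}$ and $\mathrm{Sym}_3(V)$ is the space of symmetric tensors in $\mathbb{R}^{V\times V\times V}$. The third-order moment model $\mathcal{M}^{\leq 3}(G)\subseteq PD(V)\times\mathrm{Sym}_3(V)$ is the set of all pairs $(S,T)$ with $$S=(I-\Lambda)^{-T}\Omega^{(2)}(I-\Lambda)^{-1},\qquad T=\Omega^{(3)}\bullet(I-\Lambda)^{-1}\bullet(I-\Lambda)^{-1}\bullet(I-\Lambda)^{-1},$$ where $\Omega^{(2)}\in PD(V)$ is diagonal, $\Omega^{(3)}\in\mathrm{Sym}_3(V)$ is diagonal, and $\Lambda\in\mathbb{R}^E$; the Tucker product is $(\Omega\bullet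 M\bullet M\bullet M)_{ijk}=\sum_{a,b,c}\Omega_{abc}M_{ai}M_{bj}M_{ck}$. The third-order moment ideal $\mathcal{I}^{\leq 3}(G)\subseteq\mathbb{C}[s_{ij},t_{ijk}\mid 1\le i\le j\le k\le n]$ is the ideal of all polynomials in the entries $S=(s_{ij})$, $T=(t_{ijk})$ that vanish on $\mathcal{M}^{\leq 3}(G)$ (indices of $s$ and $t$ are symmetric). A $k$-trek between $i_1,\dots,i_k\in V$ is an ordered collection $\tau=(P_1,\dots,P_k)$ of directed paths (possibly empty, i.e. a single vertex) such that $P_r$ has sink $i_r$ and all $P_r$ share the same source, called the top of $\tau$. It is simple if its top is the only vertex lying on all $k$ paths. In a polytree, if a $k$-trek between $i_1,\dots,i_k$ exists, there is a unique simple one, and $\operatorname{top}(i_1,\dots,i_k)$ denotes its top. Trek-matrix: for vertices $i,j$ of a polytree such that a 2-trek between $i$ and $j$ exists, $$A_{i,j}=\begin{pmatrix}s_{ik_1}&\cdots&s_{ik_r}&t_{i\ell_1m_1}&\cdots&t_{i\ell_qm_q}\\ s_{jk_1}&\cdots&s_{jk_r}&t_{j\ell_1m_1}&\cdots&t_{j\ell_qm_q}\end{pmatrix},$$ where $k_1,\dots,k_r$ are all vertices $k$ such that $\operatorname{top}(i,k)$ and $\operatorname{top}(j,k)$ exist and are equal, and $(\ell_1,m_1),\dots,(\ell_q,m_q)$ are all (unordered, possibly repeated-entry) pairs of vertices $(\ell,m)$ such that $\operatorname{top}(i,\ell,m)$ and $\operatorname{top}(j,\ell,m)$ exist and are equal.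 *)

theory Defs
  imports "HOL-Analysis.Analysis" "HOL-Library.Poly_Mapping"
begin

section \<open>Polytrees, treks and tops\<close>

text \<open>
  A directed graph has the finite type \<open>'v\<close> as its vertex set and is given by its
  edge set; \<open>(i, j) \<in> E\<close> means \<open>i \<rightarrow> j\<close>. The linear order on \<open>'v\<close> plays the role of the
  order of \<open>{1, \<dots>, n}\<close>: it only serves to list each unordered index set once.
\<close>

definition adjacent :: "('v \<times> 'v) set \<Rightarrow> 'v \<Rightarrow> 'v \<Rightarrow> bool" where
  "adjacent E i j \<longleftrightarrow> (i, j) \<in> E \<or> (j, i) \<in> E"

definition undirected_cycle :: "('v \<times> 'v) set \<Rightarrow> 'v list \<Rightarrow> bool" where
  "undirected_cycle E c \<longleftrightarrow>
     3 \<le> length c \<and> distinct c \<and> successively (adjacent E) c \<and> adjacent E (last c) (hd c)"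

definition undirected_tree :: "('v \<times> 'v) set \<Rightarrow> bool" where
  "undirected_tree E \<longleftrightarrow>
     (\<forall>i j. (adjacent E)\<^sup>*\<^sup>* i j) \<and> \<not> (\<exists>c. undirected_cycle E c)"

text \<open>Acyclicity excludes loops and pairs of opposite edges, so the underlying
  undirected graph of a polytree is simple.\<close>

definition polytree :: "('v::finite \<times> 'v) set \<Rightarrow> bool" where
  "polytree E \<longleftrightarrow> acyclic E \<and> undirected_tree E"

text \<open>Directed paths are nonempty vertex lists; \<open>[v]\<close> is the empty path at \<open>v\<close>.\<close>

definition directed_path :: "('v \<times> 'v) set \<Rightarrow> 'v list \<Rightarrow> bool" where
  "directed_path E p \<longleftrightarrow>
     p \<noteq> [] \<and> distinct p \<and> successively (\<lambda>a b. (a, b) \<in> E) p"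

definition trek :: "('v \<times> 'v) set \<Rightarrow> 'v list \<Rightarrow> 'v \<Rightarrow> 'v list list \<Rightarrow> bool" where
  "trek E is v Ps \<longleftrightarrow>
     list_all2 (\<lambda>i P. directed_path E P \<and> hd P = v \<and> last P = i) is Ps"

definition has_trek :: "('v \<times> 'v) set \<Rightarrow> 'v list \<Rightarrow> bool" where
  "has_trek E is \<longleftrightarrow> (\<exists>v Ps. trek E is v Ps)"

definition simple_trek :: "('v \<times> 'v) set \<Rightarrow> 'v list \<Rightarrow> 'v \<Rightarrow> 'v list list \<Rightarrow> bool" where
  "simple_trek E is v Ps \<longleftrightarrow> trek E is v Ps \<and> (\<Inter>P\<in>set Ps. set P) = {v}"

text \<open>Only meaningful if a trek between the given vertices exists.\<close>

definition trek_top :: "('v \<times> 'v) set \<Rightarrow> 'v list \<Rightarrow> 'v" where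
  "trek_top E is = (THE v. \<exists>Ps. simple_trek E is v Ps)"


section \<open>The third-order moment model\<close>

definition positive_definite :: "real^'v^'v \<Rightarrow> bool" where
  "positive_definite S \<longleftrightarrow> transpose S = S \<and> (\<forall>x. x \<noteq> 0 \<longrightarrow> 0 < x \<bullet> (S *v x))"

definition diagonal :: "real^'v^'v \<Rightarrow> bool" where
  "diagonal S \<longleftrightarrow> (\<forall>i j. i \<noteq> j \<longrightarrow> S $ i $ j = 0)"

definition symmetric_tensor :: "real^'v^'v^'v \<Rightarrow> bool" where
  "symmetric_tensor T \<longleftrightarrow>
     (\<forall>i j k. T $ i $ j $ k = T $ j $ i $ k \<and> T $ i $ j $ k = T $ i $ k $ j)"

definition diagonal_tensor :: "real^'v^'v^'v \<Rightarrow> bool" where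
  "diagonal_tensor T \<longleftrightarrow> (\<forall>i j k. \<not> (i = j \<and> j = k) \<longrightarrow> T $ i $ j $ k = 0)"

definition tucker ::
    "real^'v^'v^'v \<Rightarrow> real^'v^'v \<Rightarrow> real^'v^'v \<Rightarrow> real^'v^'v \<Rightarrow> real^'v^'v^'v" where
  "tucker T L M N = (\<chi> i j k. \<Sum>a\<in>UNIV. \<Sum>b\<in>UNIV. \<Sum>c\<in>UNIV.
     T $ a $ b $ c * L $ a $ i * M $ b $ j * N $ c $ k)"

definition edge_matrices :: "('v \<times> 'v) set \<Rightarrow> (real^'v^'v) set" where
  "edge_matrices E = {\<Lambda>. \<forall>i j. (i, j) \<notin> E \<longrightarrow> \<Lambda> $ i $ j = 0}"

definition moment_model :: "('v \<times> 'v) set \<Rightarrow> ((real^'v^'v) \<times> (real^'v^'v^'v)) set" where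
  "moment_model E =
     {(transpose B ** \<Omega>2 ** B, tucker \<Omega>3 B B B) | \<Omega>2 \<Omega>3 \<Lambda> B.
        positive_definite \<Omega>2 \<and> diagonal \<Omega>2 \<and>
        symmetric_tensor \<Omega>3 \<and> diagonal_tensor \<Omega>3 \<and>
        \<Lambda> \<in> edge_matrices E \<and> B = matrix_inv (mat 1 - \<Lambda>)}"


section \<open>The polynomial ring\<close>

text \<open>
  The sorted list \<open>[i, j]\<close> stands for the variable \<open>s\<^sub>i\<^sub>j\<close> and the sorted list \<open>[i, j, k]\<close>
  for \<open>t\<^sub>i\<^sub>j\<^sub>k\<close>, so the type below consists of exactly the variables
  \<open>s\<^sub>i\<^sub>j\<close> with \<open>i \<le> j\<close> and \<open>t\<^sub>i\<^sub>j\<^sub>k\<close> with \<open>i \<le> j \<le> k\<close>.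
\<close>

typedef (overloaded) 'v moment_var =
    "{xs :: 'v::linorder list. sorted xs \<and> (length xs = 2 \<or> length xs = 3)}"
  by (rule exI[of _ "[undefined, undefined]"]) simp

text \<open>Polynomials map monomials, i.e. finitely supported exponent vectors, to coefficients.\<close>

type_synonym 'v moment_poly = "('v moment_var \<Rightarrow>\<^sub>0 nat) \<Rightarrow>\<^sub>0 complex"

definition poly_var :: "'v::linorder moment_var \<Rightarrow> 'v moment_poly" where
  "poly_var x = Poly_Mapping.single (Poly_Mapping.single x 1) 1"

definition s_var :: "'v::linorder \<Rightarrow> 'v \<Rightarrow> 'v moment_poly" where
  "s_var i j = poly_var (Abs_moment_var (sort [i, j]))"

definition t_var :: "'v::linorder \<Rightarrow> 'v \<Rightarrow> 'v \<Rightarrow> 'v moment_poly" where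
  "t_var i j k = poly_var (Abs_moment_var (sort [i, j, k]))"

definition poly_eval :: "('v::linorder moment_var \<Rightarrow> complex) \<Rightarrow> 'v moment_poly \<Rightarrow> complex" where
  "poly_eval \<xi> f = (\<Sum>m\<in>Poly_Mapping.keys f. Poly_Mapping.lookup f m *
     (\<Prod>x\<in>Poly_Mapping.keys m. \<xi> x ^ Poly_Mapping.lookup m x))"

definition moment_point ::
    "real^('v::{finite,linorder})^('v::{finite,linorder}) \<Rightarrow>
     real^('v::{finite,linorder})^('v::{finite,linorder})^('v::{finite,linorder}) \<Rightarrow>
     'v moment_var \<Rightarrow> complex" where
  "moment_point S T x = complex_of_real
     (let xs = Rep_moment_var x in
      if length xs = 2 then S $ (xs ! 0) $ (xs ! 1) else T $ (xs ! 0) $ (xs ! 1) $ (xs ! 2))"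

definition moment_ideal :: "('v::{finite,linorder} \<times> 'v) set \<Rightarrow> 'v moment_poly set" where
  "moment_ideal E =
     {f. \<forall>(S, T) \<in> moment_model E. poly_eval (moment_point S T) f = 0}"


section \<open>Trek-matrices and their ideal\<close>

lemma module_times: "module ((*) :: 'a::comm_ring_1 \<Rightarrow> 'a \<Rightarrow> 'a)"
  by unfold_locales (simp_all add: algebra_simps)

text \<open>The ideal generated by \<open>B\<close> is the span of \<open>B\<close> in the ring as a module over itself.\<close>

definition ideal_generated_by :: "'a::comm_ring_1 set \<Rightarrow> 'a set" where
  "ideal_generated_by B = module.span (*) B"

text \<open>Columns of trek-matrices: \<open>SCol k\<close> is the column with entries \<open>s\<^sub>i\<^sub>k\<close>, \<open>s\<^sub>j\<^sub>k\<close>, and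
  \<open>TCol l m\<close> is the column with entries \<open>t\<^sub>i\<^sub>l\<^sub>m\<close>, \<open>t\<^sub>j\<^sub>l\<^sub>m\<close>.\<close>

datatype 'v trek_col = SCol 'v | TCol 'v 'v

definition same_top :: "('v \<times> 'v) set \<Rightarrow> 'v \<Rightarrow> 'v \<Rightarrow> 'v list \<Rightarrow> bool" where
  "same_top E i j ks \<longleftrightarrow> has_trek E (i # ks) \<and> has_trek E (j # ks) \<and>
     trek_top E (i # ks) = trek_top E (j # ks)"

definition trek_cols :: "('v::linorder \<times> 'v) set \<Rightarrow> 'v \<Rightarrow> 'v \<Rightarrow> 'v trek_col set" where
  "trek_cols E i j =
     {SCol k | k. same_top E i j [k]} \<union> {TCol l m | l m. l \<le> m \<and> same_top E i j [l, m]}"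

definition trek_matrix :: "'v::linorder \<Rightarrow> 'v \<Rightarrow> 2 \<Rightarrow> 'v trek_col \<Rightarrow> 'v moment_poly" where
  "trek_matrix i j r c =
     (let u = (if r = 1 then i else j) in
      case c of SCol k \<Rightarrow> s_var u k | TCol l m \<Rightarrow> t_var u l m)"

definition trek_minors :: "('v::linorder \<times> 'v) set \<Rightarrow> 'v \<Rightarrow> 'v \<Rightarrow> 'v moment_poly set" where
  "trek_minors E i j =
     {det (\<chi> r. \<chi> q :: 2. trek_matrix i j r (if q = 1 then c else d)) | c d.
        c \<in> trek_cols E i j \<and> d \<in> trek_cols E i j \<and> c \<noteq> d}"

definition trek_ideal :: "('v::linorder \<times> 'v) set \<Rightarrow> 'v moment_poly set" where
  "trek_ideal E = ideal_generated_by
     (\<Union> {trek_minors E i j | i j. has_trek E [i, j]} \<union>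
      {s_var i j | i j. \<not> has_trek E [i, j]} \<union>
      {t_var i j k | i j k. \<not> has_trek E [i, j, k]})"

end

theory Submission
  imports Defs "HOL-Combinatorics.Transposition" "HOL-Computational_Algebra.Polynomial"
begin

text \<open>
  The trek rule turns the model into a monomial parametrization: if \<open>w\<close> is the top of the indices, a
  second- or third-order moment is the diagonal moment at \<open>w\<close> times the edge weights along the paths
  from \<open>w\<close>, and the diagonal moments and the edge weights are algebraically independent. So the
  moment ideal is toric, and what has to be shown is that two monomials with the same tops and
  the same number of paths through each edge are congruent modulo the minors. Regard a monomial as an
  assignment of sinks to slots, grouped in blocks with fixed tops; a minor exchanges the sinks of two
  slots whenever all tops are preserved. Going through the vertices from the sources
  downwards, the outgoing edges taken at a vertex by the paths through it can be made to coincide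
  for both monomials by legal exchanges.
\<close>

section \<open>Reachability and tops in polytrees\<close>


text \<open>The obstacle is that every exchange must keep the tops. Exchanging two sinks whose paths
  pass through \<open>z\<close> cannot harm a block whose top lies strictly above \<open>z\<close>,
  because the child through which such a path leaves its top is determined by \<open>z\<close>. Only
  blocks with top \<open>z\<close> are at risk: their paths must not all leave \<open>z\<close>
  through one child, while a path that stops at \<open>z\<close> is always harmless. What remains at
  \<open>z\<close> is a problem about rows of symbols: two fillings with equal symbol counts have to
  be connected by transpositions that never make certain rows constant in certain symbols. The
  transposition that repairs a mismatch may be forbidden, and for this reason both fillings are
  moved towards each other. The model consists of real points subject to positivity. Instead of its
  Zariski closure, a single real curve inside it is used for each polynomial, with exponents chosen
  so that monomials of different degrees in the parameters become different powers of the curve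
  parameter.\<close>

lemma rtranclp_imp_distinct_path:
  assumes "R\<^sup>*\<^sup>* a b"
  shows "\<exists>p. p \<noteq> [] \<and> distinct p \<and> successively R p \<and> hd p = a \<and> last p = b"
  using assms
proof (induction rule: converse_rtranclp_induct)
  case base
  show ?case by (rule exI[of _ "[b]"]) simp
next
  case (step a c)
  then obtain p where p: "p \<noteq> []" "distinct p" "successively R p" "hd p = c" "last p = b"
    by blast
  show ?case
  proof (cases "a \<in> set p")
    case True
    then obtain xs ys where "p = xs @ a # ys"
      by (meson split_list)
    then show ?thesis
      using p by (intro exI[of _ "a # ys"]) (auto simp: successively_append_iff)
  next
    case False
    then show ?thesis
      using p step.hyps(1) by (intro exI[of _ "a # p"]) (auto simp: successively_Cons)
  qed
qed

lemma successively_imp_rtranclp: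
  assumes "successively R p" "x \<in> set p"
  shows "R\<^sup>*\<^sup>* (hd p) x" "R\<^sup>*\<^sup>* x (last p)"
proof -
  have "R\<^sup>*\<^sup>* (hd p) x \<and> R\<^sup>*\<^sup>* x (last p)" using assms
  proof (induction p arbitrary: x)
    case (Cons a p)
    show ?case
    proof (cases "p = []")
      case False
      then have "R a (hd p)" and s: "successively R p"
        using Cons.prems(1) by (auto simp: successively_Cons)
      then show ?thesis
        using Cons.IH[OF s] Cons.prems(2) False
        by (auto intro: converse_rtranclp_into_rtranclp)
    qed (use Cons in auto)
  qed simp
  then show "R\<^sup>*\<^sup>* (hd p) x" "R\<^sup>*\<^sup>* x (last p)" by auto
qed

locale polytree_graph =
  fixes E :: "('v::{finite,linorder} \<times> 'v) set"
  assumes polytree: "polytree E"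
begin

abbreviation reaches :: "'v \<Rightarrow> 'v \<Rightarrow> bool" (infix "\<preceq>" 50) where
  "u \<preceq> v \<equiv> (u, v) \<in> E\<^sup>*"

lemma acyclic: "acyclic E"
  using polytree by (simp add: polytree_def)

lemma antisym: "u \<preceq> v \<Longrightarrow> v \<preceq> u \<Longrightarrow> u = v"
  using acyclic acyclic_impl_antisym_rtrancl antisymD by metis

lemma not_reaches_parent: "(u, v) \<in> E \<Longrightarrow> \<not> v \<preceq> u"
  using acyclic by (meson acyclic_def rtrancl_into_trancl2)

lemma no_loop: "(u, u) \<notin> E"
  using not_reaches_parent by blast

text \<open>
  \<open>side u v\<close> is the component of \<open>v\<close> once the edge \<open>u \<rightarrow> v\<close> is deleted. As it does not contain \<open>u\<close>, a
  directed path uses this edge iff it changes sides; all tree arguments below reduce to this.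
\<close>

definition side :: "'v \<Rightarrow> 'v \<Rightarrow> 'v \<Rightarrow> bool" where
  "side u v = (\<lambda>a b. adjacent E a b \<and> {a, b} \<noteq> {u, v})\<^sup>*\<^sup>* v"

lemma side_head: "side u v v"
  by (simp add: side_def)

text \<open>A walk without repetition from \<open>v\<close> to \<open>u\<close> that avoids the edge
  would close up to an undirected cycle; a walk on just two vertices would be the deleted edge
  itself.\<close>

lemma not_side_tail:
  assumes "(u, v) \<in> E"
  shows "\<not> side u v u"
proof
  assume "side u v u"
  then obtain p where p: "p \<noteq> []" "distinct p" "hd p = v" "last p = u"
      and s: "successively (\<lambda>a b. adjacent E a b \<and> {a, b} \<noteq> {u, v}) p"
    unfolding side_def by (blast dest: rtranclp_imp_distinct_path)
  have "u \<noteq> v" using assms no_loop by blast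
  have "3 \<le> length p"
  proof (rule ccontr)
    assume "\<not> 3 \<le> length p"
    then consider "length p = 0" | "length p = 1" | "length p = 2" by linarith
    then show False
      using p s \<open>u \<noteq> v\<close> by cases (auto simp: length_Suc_conv numeral_2_eq_2)
  qed
  moreover have "successively (adjacent E) p"
    using s by (rule successively_mono) simp
  moreover have "adjacent E (last p) (hd p)"
    using p assms by (simp add: adjacent_def)
  ultimately have "undirected_cycle E p"
    using p by (simp add: undirected_cycle_def)
  then show False
    using polytree by (auto simp: polytree_def undirected_tree_def)
qed

lemma side_edge:
  assumes "(u, v) \<in> E" "(a, b) \<in> E" "(a, b) \<noteq> (u, v)"
  shows "side u v a \<longleftrightarrow> side u v b"
proof -
  have "{a, b} \<noteq> {u, v}"
    using assms not_reaches_parent by (auto simp: doubleton_eq_iff)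
  then have "adjacent E a b \<and> {a, b} \<noteq> {u, v}" "adjacent E b a \<and> {b, a} \<noteq> {u, v}"
    using assms by (auto simp: adjacent_def)
  then show ?thesis
    unfolding side_def
    using rtranclp.rtrancl_into_rtrancl[of "\<lambda>a b. adjacent E a b \<and> {a, b} \<noteq> {u, v}" v a b]
      rtranclp.rtrancl_into_rtrancl[of "\<lambda>a b. adjacent E a b \<and> {a, b} \<noteq> {u, v}" v b a]
    by blast
qed

text \<open>The side changes only along the edge from \<open>u\<close> to \<open>v\<close>, and the
  last hypothesis keeps this edge off every path from \<open>a\<close> to \<open>b\<close>.\<close>

lemma side_eq:
  assumes e: "(u, v) \<in> E" and "a \<preceq> b" and "\<not> (a \<preceq> u \<and> v \<preceq> b)"
  shows "side u v a \<longleftrightarrow> side u v b"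
  using assms(2,3)
proof (induction rule: converse_rtrancl_induct)
  case (step a c)
  have "(a, c) \<noteq> (u, v)" using step by auto
  then show ?case
    using step side_edge[OF e step.hyps(1)] by (meson converse_rtrancl_into_rtrancl)
qed simp

lemma side_above: "(u, v) \<in> E \<Longrightarrow> a \<preceq> u \<Longrightarrow> \<not> side u v a"
  using side_eq not_reaches_parent not_side_tail by blast

lemma side_below: "(u, v) \<in> E \<Longrightarrow> v \<preceq> b \<Longrightarrow> side u v b"
  using side_eq not_reaches_parent side_head by blast

text \<open>Turns a joint condition on both endpoints into a difference of two conditions on single
  vertices. This makes path weights multiplicative and lets crossings be counted by looking at sinks
  only.\<close>

lemma crosses_iff_side:
  assumes "(u, v) \<in> E" "a \<preceq> b"
  shows "a \<preceq> u \<and> v \<preceq> b \<longleftrightarrow> side u v b \<and> \<not> side u v a"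
  using assms side_above side_below side_eq by blast

lemma side_mono: "(u, v) \<in> E \<Longrightarrow> a \<preceq> b \<Longrightarrow> side u v a \<Longrightarrow> side u v b"
  using side_below side_eq by blast

text \<open>The edge from \<open>w\<close> to \<open>c\<close> separates \<open>c\<close> from
  \<open>d\<close>, and a directed path starting at \<open>d\<close> never returns to
  \<open>w\<close> to cross it.\<close>

lemma child_unique:
  assumes "(w, c) \<in> E" "(w, d) \<in> E" "c \<preceq> x" "d \<preceq> x"
  shows "c = d"
proof (rule ccontr)
  assume "c \<noteq> d"
  then have "\<not> side w c d"
    using side_edge[OF assms(1,2)] not_side_tail[OF assms(1)] by auto
  moreover have "side w c x" using assms side_below by blast
  ultimately show False
    using side_eq[OF assms(1,4)] not_reaches_parent[OF assms(2)] by blast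
qed

lemma reaches_cases: "w \<preceq> x \<Longrightarrow> w = x \<or> (\<exists>c. (w, c) \<in> E \<and> c \<preceq> x)"
  by (meson converse_rtranclE)

text \<open>The path from \<open>a\<close> to \<open>x\<close> is unique, by
  \<open>child_unique\<close> at each of its vertices, and both \<open>u\<close> and
  \<open>v\<close> lie on it.\<close>

lemma interval_linear:
  assumes "a \<preceq> u" "u \<preceq> x" "a \<preceq> v" "v \<preceq> x"
  shows "u \<preceq> v \<or> v \<preceq> u"
  using assms(1,3)
proof (induction rule: converse_rtrancl_induct)
  case (step a c)
  show ?case
  proof (cases "a = v")
    case True
    then show ?thesis using step by (meson converse_rtrancl_into_rtrancl)
  next
    case False
    then obtain d where d: "(a, d) \<in> E" "d \<preceq> v" using step.prems reaches_cases by blast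
    have "c = d"
      using child_unique[OF step.hyps(1) d(1)] step.hyps(2) assms(2,4) d(2)
      by (meson rtrancl_trans)
    then show ?thesis using step.IH d by blast
  qed
qed simp

text \<open>The path-free form of the top. Testing only the children of \<open>w\<close> makes it
  local, and this local condition is what an exchange has to preserve.\<close>

definition is_top :: "'v \<Rightarrow> 'v list \<Rightarrow> bool" where
  "is_top w xs \<longleftrightarrow>
     (\<forall>x\<in>set xs. w \<preceq> x) \<and> \<not> (\<exists>c. (w, c) \<in> E \<and> (\<forall>x\<in>set xs. c \<preceq> x))"

lemma is_top_cong: "set xs = set ys \<Longrightarrow> is_top w xs = is_top w ys"
  by (simp add: is_top_def)

text \<open>Unless \<open>w\<close> is itself an entry, some child \<open>c\<close> of
  \<open>w\<close> reaches an entry \<open>x\<close> but not another entry \<open>y\<close>. Then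
  \<open>y\<close>, and with it every ancestor of \<open>y\<close>, lies on the side of
  \<open>w\<close>, so the path from \<open>b\<close> to \<open>x\<close> must cross the edge from
  \<open>w\<close> to \<open>c\<close>.\<close>

lemma is_top_greatest:
  assumes "xs \<noteq> []" "is_top w xs" "\<forall>x\<in>set xs. b \<preceq> x"
  shows "b \<preceq> w"
proof (cases "w \<in> set xs")
  case False
  obtain x where x: "x \<in> set xs" using assms(1) by fastforce
  then obtain c where c: "(w, c) \<in> E" "c \<preceq> x"
    using assms(2) False reaches_cases unfolding is_top_def by blast
  obtain y where y: "y \<in> set xs" "\<not> c \<preceq> y"
    using assms(2) c unfolding is_top_def by blast
  then have "w \<preceq> y" using assms(2) by (simp add: is_top_def)
  then have "\<not> side w c y"
    using side_eq[OF c(1) \<open>w \<preceq> y\<close>] y not_side_tail[OF c(1)] by blast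
  then have "\<not> side w c b"
    using side_mono[OF c(1)] assms(3) y by blast
  moreover have "side w c x" using side_below c by blast
  ultimately show ?thesis
    using side_eq[OF c(1)] assms(3) x by blast
qed (use assms in auto)

lemma is_top_unique: "xs \<noteq> [] \<Longrightarrow> is_top w xs \<Longrightarrow> is_top w' xs \<Longrightarrow> w = w'"
  using is_top_greatest antisym by (metis is_top_def)

lemma wf_edges: "wf E" "wf (E\<inverse>)"
  using acyclic by (auto intro: finite_acyclic_wf finite_acyclic_wf_converse)

lemma is_top_exists:
  assumes "\<forall>x\<in>set xs. b \<preceq> x"
  shows "\<exists>w. is_top w xs"
  using wf_edges(2) assms
proof (induction b rule: wf_induct_rule)
  case (less b)
  then show ?case unfolding is_top_def by (metis converse_iff)
qed

section \<open>Treks and their tops in terms of reachability\<close>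

lemma reaches_iff_directed_path:
  "a \<preceq> b \<longleftrightarrow> (\<exists>p. directed_path E p \<and> hd p = a \<and> last p = b)"
proof
  assume "a \<preceq> b"
  then have "(\<lambda>x y. (x, y) \<in> E)\<^sup>*\<^sup>* a b" by (simp add: rtranclp_rtrancl_eq)
  then show "\<exists>p. directed_path E p \<and> hd p = a \<and> last p = b"
    unfolding directed_path_def by (blast dest: rtranclp_imp_distinct_path)
next
  assume "\<exists>p. directed_path E p \<and> hd p = a \<and> last p = b"
  then obtain p where "directed_path E p" "hd p = a" "last p = b" by blast
  then show "a \<preceq> b"
    using successively_imp_rtranclp(1)[of "\<lambda>x y. (x, y) \<in> E" p b]
    by (auto simp: directed_path_def rtranclp_rtrancl_eq)
qed

lemma directed_path_between:
  assumes "directed_path E p" "x \<in> set p"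
  shows "hd p \<preceq> x" "x \<preceq> last p"
  using successively_imp_rtranclp[of "\<lambda>x y. (x, y) \<in> E" p x] assms
  by (auto simp: directed_path_def rtranclp_rtrancl_eq)

lemma trek_exists_iff: "(\<exists>Ps. trek E is v Ps) \<longleftrightarrow> (\<forall>i\<in>set is. v \<preceq> i)"
proof (induction "is")
  case Nil
  then show ?case by (auto simp: trek_def)
next
  case (Cons i "is")
  have "(\<exists>Ps. trek E (i # is) v Ps) \<longleftrightarrow> v \<preceq> i \<and> (\<exists>Ps. trek E is v Ps)"
    unfolding reaches_iff_directed_path by (auto simp: trek_def list_all2_Cons1)
  then show ?case using Cons by simp
qed

lemma has_trek_iff: "has_trek E is \<longleftrightarrow> (\<exists>v. \<forall>i\<in>set is. v \<preceq> i)"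
  using trek_exists_iff by (auto simp: has_trek_def)

lemma has_trek_iff_is_top: "has_trek E is \<longleftrightarrow> (\<exists>w. is_top w is)"
  using is_top_exists by (auto simp: has_trek_iff is_top_def)

text \<open>A child of \<open>v\<close> reaching all sinks would lie on every path of the trek,
  since paths are determined by their endpoints; conversely a second common vertex lies below a
  child of \<open>v\<close> that reaches all sinks.\<close>

lemma simple_trek_iff_is_top:
  assumes "is \<noteq> []"
  shows "(\<exists>Ps. simple_trek E is v Ps) \<longleftrightarrow> is_top v is"
proof
  assume "\<exists>Ps. simple_trek E is v Ps"
  then obtain Ps where tr: "trek E is v Ps" and int: "(\<Inter>P\<in>set Ps. set P) = {v}"
    by (auto simp: simple_trek_def)
  have "\<forall>i\<in>set is. v \<preceq> i" using tr trek_exists_iff by blast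
  moreover have False if c: "(v, c) \<in> E" "\<forall>i\<in>set is. c \<preceq> i" for c
  proof -
    have "c \<in> set P" if P: "P \<in> set Ps" for P
    proof -
      have P: "directed_path E P" "hd P = v" "last P \<in> set is"
        using tr P unfolding trek_def by (auto simp: list_all2_conv_all_nth in_set_conv_nth)
      then have "c \<preceq> last P" using c by blast
      obtain q where q: "P = v # q" using P by (cases P) (auto simp: directed_path_def)
      have "q \<noteq> []" using \<open>c \<preceq> last P\<close> q not_reaches_parent[OF c(1)] by auto
      then obtain d r where "q = d # r" by (cases q) auto
      then have "(v, d) \<in> E" "d \<preceq> last P"
        using P(1) q directed_path_between(2)[OF P(1), of d] by (auto simp: directed_path_def)
      then have "c = d" using child_unique c(1) \<open>c \<preceq> last P\<close> by blast
      then show ?thesis using q \<open>q = d # r\<close> by simp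
    qed
    then have "c \<in> {v}" using int by blast
    then show False using c no_loop by blast
  qed
  ultimately show "is_top v is" unfolding is_top_def by blast
next
  assume top: "is_top v is"
  then obtain Ps where tr: "trek E is v Ps"
    using trek_exists_iff by (metis is_top_def)
  have path: "directed_path E P \<and> hd P = v" if "P \<in> set Ps" for P
    using tr that unfolding trek_def by (auto simp: list_all2_conv_all_nth in_set_conv_nth)
  have sinks: "\<exists>P\<in>set Ps. last P = i" if "i \<in> set is" for i
    using tr that unfolding trek_def by (fastforce simp: list_all2_conv_all_nth in_set_conv_nth)
  have "z = v" if z: "\<forall>P\<in>set Ps. z \<in> set P" for z
  proof (rule ccontr)
    assume "z \<noteq> v"
    have below: "\<forall>i\<in>set is. z \<preceq> i"
      using z sinks path directed_path_between(2) by blast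
    obtain P where "P \<in> set Ps" using assms sinks by (metis last_in_set)
    then have "v \<preceq> z" using path z directed_path_between(1) by blast
    then obtain c where c: "(v, c) \<in> E" "c \<preceq> z" using \<open>z \<noteq> v\<close> reaches_cases by blast
    then have "\<forall>i\<in>set is. c \<preceq> i" using below by (meson rtrancl_trans)
    then show False using top c(1) unfolding is_top_def by blast
  qed
  moreover have "v \<in> set P" if "P \<in> set Ps" for P
    using path[OF that] by (auto simp: directed_path_def)
  ultimately have "(\<Inter>P\<in>set Ps. set P) = {v}" by blast
  then show "\<exists>Ps. simple_trek E is v Ps" using tr by (auto simp: simple_trek_def)
qed

lemma trek_top_eq:
  assumes "is \<noteq> []" "is_top w is"
  shows "trek_top E is = w"
  unfolding trek_top_def simple_trek_iff_is_top[OF assms(1)]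
proof (rule the_equality)
  show "is_top w is" by (rule assms(2))
  show "v = w" if "is_top v is" for v
    using is_top_unique[OF assms(1) that assms(2)] .
qed

lemma same_top_iff: "same_top E i j ks \<longleftrightarrow> (\<exists>w. is_top w (i # ks) \<and> is_top w (j # ks))"
  (is "?L \<longleftrightarrow> ?R")
proof
  assume ?L
  then have "has_trek E (i # ks)" "has_trek E (j # ks)" "trek_top E (i # ks) = trek_top E (j # ks)"
    by (auto simp only: same_top_def)
  moreover from this(1,2) obtain v w where vw: "is_top v (i # ks)" "is_top w (j # ks)"
    unfolding has_trek_iff_is_top by fast
  ultimately have "v = w"
    by (simp add: trek_top_eq)
  then show ?R using vw by fast
next
  assume ?R
  then obtain w where w: "is_top w (i # ks)" "is_top w (j # ks)" by fast
  then have "has_trek E (i # ks)" "has_trek E (j # ks)"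
    unfolding has_trek_iff_is_top by fast+
  moreover have "trek_top E (i # ks) = trek_top E (j # ks)"
    using w by (simp add: trek_top_eq)
  ultimately show ?L
    by (simp only: same_top_def)
qed

end

section \<open>Exchanging symbols between rows\<close>

abbreviation exchange :: "'s \<Rightarrow> 's \<Rightarrow> 's \<Rightarrow> 's" where
  "exchange \<equiv> Transposition.transpose"

lemmas exchange_def = Transposition.transpose_def

text \<open>Only the new assignment is required to be legal; along a chain that starts at a legal
  assignment the old one is legal by induction.\<close>

definition swap_step :: "'s set \<Rightarrow> (('s \<Rightarrow> 'c) \<Rightarrow> bool) \<Rightarrow> ('s \<Rightarrow> 'c) \<Rightarrow> ('s \<Rightarrow> 'c) \<Rightarrow> bool" where
  "swap_step A ok f f' \<longleftrightarrow> (\<exists>s\<in>A. \<exists>t\<in>A. f' = f \<circ> exchange s t \<and> ok f')"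

lemma swap_stepE:
  assumes "swap_step A ok f f'"
  obtains s t where "s \<in> A" "t \<in> A" "f' = f \<circ> exchange s t" "ok f'"
  using assms by (auto simp: swap_step_def)

lemma swap_step_invariants:
  assumes "(swap_step A ok)\<^sup>*\<^sup>* f f'" "ok f"
  shows "ok f'" "card {s\<in>A. P (f' s)} = card {s\<in>A. P (f s)}"
proof -
  have "ok f' \<and> card {s\<in>A. P (f' s)} = card {s\<in>A. P (f s)}"
    using assms
  proof (induction rule: rtranclp_induct)
    case (step g g')
    then obtain s t where st: "s \<in> A" "t \<in> A" "g' = g \<circ> exchange s t" "ok g'"
      by (auto simp: swap_step_def)
    have "bij_betw (exchange s t) {x\<in>A. P (g' x)} {x\<in>A. P (g x)}"
      using st by (intro bij_betwI[where g = "exchange s t"]) (auto simp: exchange_def)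
    then have "card {x\<in>A. P (g' x)} = card {x\<in>A. P (g x)}"
      by (rule bij_betw_same_card)
    then show ?case using step.IH step.prems st(4) by simp
  qed simp
  then show "ok f'" "card {s\<in>A. P (f' s)} = card {s\<in>A. P (f s)}" by auto
qed

text \<open>Rows are the fibres of \<open>blk\<close>; the rows in \<open>K\<close> must not be
  constant in a symbol of \<open>Q\<close>. In the application \<open>K\<close> holds the blocks
  whose top is the current vertex and \<open>Q\<close> its children; stopping at the vertex is a
  symbol outside \<open>Q\<close>.\<close>

definition rows_ok :: "'s set \<Rightarrow> ('s \<Rightarrow> 'b) \<Rightarrow> 'b set \<Rightarrow> 'c set \<Rightarrow> ('s \<Rightarrow> 'c) \<Rightarrow> bool" where
  "rows_ok A blk K Q f \<longleftrightarrow> (\<forall>b\<in>K. \<forall>q\<in>Q. \<exists>s\<in>A. blk s = b \<and> f s \<noteq> q)"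

lemma rows_ok_swap_same_row:
  assumes "rows_ok A blk K Q f" "s \<in> A" "t \<in> A" "blk s = blk t"
  shows "rows_ok A blk K Q (f \<circ> exchange s t)"
  unfolding rows_ok_def
proof (intro ballI)
  fix b q assume "b \<in> K" "q \<in> Q"
  then obtain x where "x \<in> A" "blk x = b" "f x \<noteq> q"
    using assms(1) by (auto simp: rows_ok_def)
  moreover from this(1,2) have "exchange s t x \<in> A" "blk (exchange s t x) = b"
    using assms(2-4) by (cases "x = s"; cases "x = t"; force)+
  ultimately show "\<exists>x\<in>A. blk x = b \<and> (f \<circ> exchange s t) x \<noteq> q"
    by (intro bexI[of _ "exchange s t x"]) simp_all
qed

text \<open>A row is spoiled only by losing its last symbol that differs from the incoming one, so
  all its other slots already carry the incoming symbol.\<close>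

lemma not_rows_ok_swap:
  assumes "rows_ok A blk K Q f" "\<not> rows_ok A blk K Q (f \<circ> exchange s t)"
    "s \<in> A" "t \<in> A" "blk s \<noteq> blk t"
  shows "blk s \<in> K \<and> f t \<in> Q \<and> (\<forall>x\<in>A. blk x = blk s \<longrightarrow> x \<noteq> s \<longrightarrow> f x = f t) \<or>
         blk t \<in> K \<and> f s \<in> Q \<and> (\<forall>x\<in>A. blk x = blk t \<longrightarrow> x \<noteq> t \<longrightarrow> f x = f s)"
proof -
  obtain b q where bq: "b \<in> K" "q \<in> Q" "\<And>x. x \<in> A \<Longrightarrow> blk x = b \<Longrightarrow> (f \<circ> exchange s t) x = q"
    using assms(2) by (auto simp: rows_ok_def)
  obtain y where y: "y \<in> A" "blk y = b" "f y \<noteq> q"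
    using assms(1) bq(1,2) unfolding rows_ok_def by blast
  have "y = s \<or> y = t" using bq(3)[OF y(1,2)] y(3) by (auto simp: exchange_def split: if_splits)
  then show ?thesis
  proof
    assume "y = s"
    then have "f t = q" using bq(3)[of s] assms y by auto
    moreover have "f x = q" if "x \<in> A" "blk x = blk s" "x \<noteq> s" for x
      using bq(3)[of x] that y \<open>y = s\<close> assms(5) by (auto simp: exchange_def split: if_splits)
    ultimately show ?thesis using bq y \<open>y = s\<close> by auto
  next
    assume "y = t"
    then have "f s = q" using bq(3)[of t] assms y by auto
    moreover have "f x = q" if "x \<in> A" "blk x = blk t" "x \<noteq> t" for x
      using bq(3)[of x] that y \<open>y = t\<close> assms(5) by (auto simp: exchange_def split: if_splits)
    ultimately show ?thesis using bq y \<open>y = t\<close> by auto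
  qed
qed

abbreviation mismatches :: "'s set \<Rightarrow> ('s \<Rightarrow> 'c) \<Rightarrow> ('s \<Rightarrow> 'c) \<Rightarrow> 's set" where
  "mismatches A f g \<equiv> {s\<in>A. f s \<noteq> g s}"

text \<open>
  Let \<open>f d = p \<noteq> g d\<close> and choose \<open>c\<close> with \<open>g c = p \<noteq> f c\<close>. If exchanging \<open>c\<close> and \<open>d\<close> is forbidden both in \<open>f\<close>
  and in \<open>g\<close>, then \<open>f\<close> is constantly \<open>f c\<close> on the rest of the row of \<open>d\<close>, and \<open>g\<close> is constantly \<open>g d\<close> on
  the rest of the row of \<open>c\<close>. A legal rotation of \<open>f\<close> through a third slot \<open>c2\<close> in the row of \<open>c\<close> helps then.
\<close>

lemma rows_ok_improvement:
  assumes fin: "finite A"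
    and two: "\<And>s. s \<in> A \<Longrightarrow> blk s \<in> K \<Longrightarrow> \<exists>t\<in>A. t \<noteq> s \<and> blk t = blk s"
    and okf: "rows_ok A blk K Q f" and okg: "rows_ok A blk K Q g"
    and cnt: "\<And>c. card {s\<in>A. f s = c} = card {s\<in>A. g s = c}"
    and d: "d \<in> A" "f d \<noteq> g d"
  shows "\<exists>f' g'. (swap_step A (rows_ok A blk K Q))\<^sup>*\<^sup>* f f' \<and> (swap_step A (rows_ok A blk K Q))\<^sup>*\<^sup>* g g' \<and>
     card (mismatches A f' g') < card (mismatches A f g)"
proof (rule ccontr)
  let ?ok = "rows_ok A blk K Q" and ?m = "mismatches A"
  let ?R = "swap_step A (rows_ok A blk K Q)"
  assume neg: "\<not> ?thesis"
  then have noimp: False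
    if "?R\<^sup>*\<^sup>* f f'" "?R\<^sup>*\<^sup>* g g'" "card (?m f' g') < card (?m f g)" for f' g'
    using that by blast
  have noimp1: False if "?R\<^sup>*\<^sup>* f f'" "?R\<^sup>*\<^sup>* g g'" "?m f' g' \<subset> ?m f g" for f' g'
    using noimp[OF that(1,2)] psubset_card_mono[OF _ that(3)] fin by auto
  have psub: "?m f' g' \<subset> ?m f g"
    if "x \<in> A" "f x \<noteq> g x" "f' x = g' x" "\<And>s. s \<in> A \<Longrightarrow> f' s \<noteq> g' s \<Longrightarrow> f s \<noteq> g s" for f' g' x
    using that by blast
  have swap: "?R\<^sup>*\<^sup>* h (h \<circ> exchange s t)" if "s \<in> A" "t \<in> A" "?ok (h \<circ> exchange s t)" for h s t
    using that unfolding swap_step_def by (intro r_into_rtranclp) blast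
  \<comment> \<open>Exchanges inside a row are always legal. Under the assumption that nothing
    improves, no mismatch can therefore be repaired within its row; most cases below are refuted in
    this way.\<close>
  have same_row: False
    if xy: "x \<in> A" "y \<in> A" "blk x = blk y" "g x = f y" "f x \<noteq> g x" "f y \<noteq> g y" for x y
  proof (rule noimp1)
    show "?R\<^sup>*\<^sup>* f (f \<circ> exchange x y)"
      by (rule swap[OF xy(1,2) rows_ok_swap_same_row[OF okf xy(1-3)]])
    show "?m (f \<circ> exchange x y) g \<subset> ?m f g"
    proof (rule psub[of x])
      fix s assume "s \<in> A" "(f \<circ> exchange x y) s \<noteq> g s"
      then show "f s \<noteq> g s"
        using xy by (cases "s = x"; cases "s = y") auto
    qed (use xy in auto)
  qed simp
  define p where "p = f d"
  have "\<exists>c\<in>A. g c = p \<and> f c \<noteq> p"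
  proof (rule ccontr)
    assume "\<not> ?thesis"
    then have "{s\<in>A. g s = p} \<subseteq> {s\<in>A. f s = p}" by auto
    then have "{s\<in>A. g s = p} = {s\<in>A. f s = p}"
      using cnt fin by (intro card_subset_eq) auto
    moreover have "d \<in> {s\<in>A. f s = p}" "d \<notin> {s\<in>A. g s = p}"
      using d by (auto simp: p_def)
    ultimately show False by blast
  qed
  then obtain c where c: "c \<in> A" "g c = p" "f c \<noteq> p" by blast
  have rows: "blk c \<noteq> blk d"
    using same_row[of c d] c d by (auto simp: p_def)
  have "c \<noteq> d" using rows by auto
  have nf: "\<not> ?ok (f \<circ> exchange c d)"
  proof
    assume "?ok (f \<circ> exchange c d)"
    then have *: "?R\<^sup>*\<^sup>* f (f \<circ> exchange c d)" by (rule swap[OF c(1) d(1)])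
    have "?m (f \<circ> exchange c d) g \<subset> ?m f g"
    proof (rule psub[of c])
      fix s assume "s \<in> A" "(f \<circ> exchange c d) s \<noteq> g s"
      then show "f s \<noteq> g s"
        using c d by (cases "s = c"; cases "s = d") (auto simp: p_def)
    qed (use c d in \<open>auto simp: p_def\<close>)
    then show False using noimp1[OF *, of g] by blast
  qed
  have D: "blk d \<in> K" "f c \<in> Q" "\<And>x. x \<in> A \<Longrightarrow> blk x = blk d \<Longrightarrow> x \<noteq> d \<Longrightarrow> f x = f c"
  proof -
    \<comment> \<open>The row of \<open>c\<close> cannot be the spoiled one: \<open>f\<close> would
      be \<open>p\<close> on the rest of it, while \<open>g\<close> differs from \<open>p\<close>
      somewhere on it, and exchanging that slot with \<open>c\<close> would be a repair inside the
      row.\<close>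
    have False
      if *: "blk c \<in> K" "f d \<in> Q" "\<forall>x\<in>A. blk x = blk c \<longrightarrow> x \<noteq> c \<longrightarrow> f x = f d"
    proof -
      obtain x where "x \<in> A" "blk x = blk c" "g x \<noteq> f d"
        using okg * unfolding rows_ok_def by blast
      then show False using same_row[of c x] * c by (auto simp: p_def)
    qed
    then show "blk d \<in> K" "f c \<in> Q" "\<And>x. x \<in> A \<Longrightarrow> blk x = blk d \<Longrightarrow> x \<noteq> d \<Longrightarrow> f x = f c"
      using not_rows_ok_swap[OF okf nf c(1) d(1) rows] by blast+
  qed
  have ng: "\<not> ?ok (g \<circ> exchange c d)"
  proof
    assume "?ok (g \<circ> exchange c d)"
    then have *: "?R\<^sup>*\<^sup>* g (g \<circ> exchange c d)" by (rule swap[OF c(1) d(1)])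
    have "?m f (g \<circ> exchange c d) \<subset> ?m f g"
    proof (rule psub[of d])
      fix s assume "s \<in> A" "f s \<noteq> (g \<circ> exchange c d) s"
      then show "f s \<noteq> g s"
        using c d by (cases "s = c"; cases "s = d") (auto simp: p_def)
    qed (use c d in \<open>auto simp: p_def\<close>)
    then show False using noimp1[OF _ *, of f] by blast
  qed
  have C: "blk c \<in> K" "g d \<in> Q" "\<And>x. x \<in> A \<Longrightarrow> blk x = blk c \<Longrightarrow> x \<noteq> c \<Longrightarrow> g x = g d"
  proof -
    have False
      if *: "blk d \<in> K" "g c \<in> Q" "\<forall>x\<in>A. blk x = blk d \<longrightarrow> x \<noteq> d \<longrightarrow> g x = g c"
    proof -
      obtain x where "x \<in> A" "blk x = blk d" "f x \<noteq> g c"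
        using okf * unfolding rows_ok_def by blast
      then show False using same_row[of x d] * c d by (auto simp: p_def)
    qed
    then show "blk c \<in> K" "g d \<in> Q" "\<And>x. x \<in> A \<Longrightarrow> blk x = blk c \<Longrightarrow> x \<noteq> c \<Longrightarrow> g x = g d"
      using not_rows_ok_swap[OF okg ng c(1) d(1) rows] by blast+
  qed
  \<comment> \<open>A second slot in the row of \<open>d\<close>. It carries \<open>f c\<close>, and
    so protects the row from becoming constant when \<open>d\<close> receives a symbol other than
    \<open>f c\<close>.\<close>
  obtain e where e: "e \<in> A" "e \<noteq> d" "blk e = blk d" using two[OF d(1) D(1)] by blast
  have "f e = f c" using D(3) e by blast
  \<comment> \<open>The rotation gives \<open>p\<close> to \<open>c\<close>, \<open>f c\<close> to
    \<open>c2\<close> and \<open>f c2\<close> to \<open>d\<close>, so \<open>c\<close> is repaired.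
    If \<open>f c2 = g d\<close>, then \<open>d\<close> is repaired as well and at most
    \<open>c2\<close> is lost. Otherwise \<open>g d\<close> does not occur in \<open>f\<close> on
    the row of \<open>c\<close>; since \<open>g c2 = g d\<close>, the slot \<open>c2\<close> was a
    mismatch before, and nothing is lost.\<close>
  have rotate: False
    if c2: "c2 \<in> A" "blk c2 = blk c" "f c2 \<noteq> f c"
      and imp: "f c2 = g d \<or> (\<forall>x\<in>A. blk x = blk c \<longrightarrow> f x \<noteq> g d)" for c2
  proof -
    have neq: "c2 \<noteq> c" "c2 \<noteq> d" using c2 rows by auto
    let ?f1 = "f \<circ> exchange c2 d" let ?f2 = "?f1 \<circ> exchange c2 c"
    have ok1: "?ok ?f1"
    proof (rule ccontr)
      assume "\<not> ?ok ?f1"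
      moreover have "blk c2 \<noteq> blk d" using c2(2) rows by simp
      ultimately consider "\<forall>x\<in>A. blk x = blk c2 \<longrightarrow> x \<noteq> c2 \<longrightarrow> f x = f d"
        | "\<forall>x\<in>A. blk x = blk d \<longrightarrow> x \<noteq> d \<longrightarrow> f x = f c2"
        using not_rows_ok_swap[OF okf _ c2(1) d(1)] by blast
      then show False
      proof cases
        case 1
        then have "f c = f d" using c(1) c2(2) neq(1) by metis
        then show False using c(3) by (simp add: p_def)
      next
        case 2
        then have "f e = f c2" using e by blast
        then show False using \<open>f e = f c\<close> c2(3) by simp
      qed
    qed
    have ok2: "?ok ?f2" by (rule rows_ok_swap_same_row[OF ok1 c2(1) c(1) c2(2)])
    have reach: "?R\<^sup>*\<^sup>* f ?f2"
      using swap[OF c2(1) d(1) ok1] swap[OF c2(1) c(1) ok2] by (rule rtranclp_trans)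
    have val: "?f2 c = g c" "?f2 c2 = f c" "?f2 d = f c2" "\<And>x. x \<notin> {c, c2, d} \<Longrightarrow> ?f2 x = f x"
      using neq \<open>c \<noteq> d\<close> c by (auto simp: exchange_def p_def)
    show False
    proof (cases "f c2 = g d")
      case True
      have "?m ?f2 g \<subseteq> insert c2 (?m f g - {c, d})"
      proof
        fix s assume s: "s \<in> ?m ?f2 g"
        then show "s \<in> insert c2 (?m f g - {c, d})"
          using val True by (cases "s \<in> {c, c2, d}") (auto simp del: comp_apply)
      qed
      then have "card (?m ?f2 g) \<le> card (insert c2 (?m f g - {c, d}))"
        using fin by (intro card_mono) auto
      also have "\<dots> \<le> Suc (card (?m f g - {c, d}))"
        using fin by (simp add: card_insert_if)
      also have "card (?m f g - {c, d}) = card (?m f g) - 2"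
        using c d \<open>c \<noteq> d\<close> by (subst card_Diff_subset) auto
      finally have "card (?m ?f2 g) \<le> Suc (card (?m f g) - 2)" .
      moreover have "card {c, d} \<le> card (?m f g)"
        using c d fin by (intro card_mono) auto
      ultimately have "card (?m ?f2 g) < card (?m f g)" using \<open>c \<noteq> d\<close> by simp
      then show False using noimp[OF reach, of g] by simp
    next
      case False
      then have "f c2 \<noteq> g c2" using imp C(3)[of c2] c2 neq by auto
      have "?m ?f2 g \<subset> ?m f g"
      proof (rule psub[of c])
        fix s assume s: "s \<in> A" "?f2 s \<noteq> g s"
        then have "s \<noteq> c" using val(1) by blast
        then consider "s = c2" | "s = d" | "s \<notin> {c, c2, d}" by blast
        then show "f s \<noteq> g s"
        proof cases
          case 3
          then show ?thesis using val(4)[OF 3] s(2) by argo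
        qed (use \<open>f c2 \<noteq> g c2\<close> d in blast)+
      qed (use val(1) c in \<open>blast+\<close>)
      then show False using noimp1[OF reach, of g] by simp
    qed
  qed
  show False
  proof (cases "\<exists>c2\<in>A. blk c2 = blk c \<and> f c2 = g d")
    case True
    then obtain c2 where c2: "c2 \<in> A" "blk c2 = blk c" "f c2 = g d" by blast
    show False
    proof (cases "f c2 = f c")
      \<comment> \<open>Here \<open>f c = g d\<close>. The row of \<open>d\<close> then contains a
        slot \<open>x\<close> with \<open>f x = g d\<close> and \<open>g x \<noteq> f x\<close>, and
        exchanging \<open>d\<close> with \<open>x\<close> is a repair inside the row.\<close>
      case True
      then obtain x where "x \<in> A" "blk x = blk d" "g x \<noteq> f c"
        using okg D unfolding rows_ok_def by blast
      moreover from this have "x \<noteq> d" using c2 True by auto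
      ultimately show False using same_row[of d x] D(3)[of x] c2 True d by auto
    qed (use rotate c2 in blast)
  next
    case False
    obtain c2 where "c2 \<in> A" "blk c2 = blk c" "f c2 \<noteq> f c"
      using okf C(1) D(2) unfolding rows_ok_def by blast
    then show False using rotate False by blast
  qed
qed

lemma rows_ok_connected:
  assumes fin: "finite A"
    and two: "\<And>s. s \<in> A \<Longrightarrow> blk s \<in> K \<Longrightarrow> \<exists>t\<in>A. t \<noteq> s \<and> blk t = blk s"
    and "rows_ok A blk K Q f" "rows_ok A blk K Q g"
    and "\<And>c. card {s\<in>A. f s = c} = card {s\<in>A. g s = c}"
  shows "\<exists>f' g'. (swap_step A (rows_ok A blk K Q))\<^sup>*\<^sup>* f f' \<and> (swap_step A (rows_ok A blk K Q))\<^sup>*\<^sup>* g g' \<and>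
     (\<forall>s\<in>A. f' s = g' s)"
  using assms(3-5)
proof (induction "card (mismatches A f g)" arbitrary: f g rule: less_induct)
  case less
  show ?case
  proof (cases "\<forall>s\<in>A. f s = g s")
    case False
    then obtain d where "d \<in> A" "f d \<noteq> g d" by blast
    from rows_ok_improvement[OF fin two less.prems this]
    obtain f1 g1 where 1: "(swap_step A (rows_ok A blk K Q))\<^sup>*\<^sup>* f f1"
        "(swap_step A (rows_ok A blk K Q))\<^sup>*\<^sup>* g g1"
        "card (mismatches A f1 g1) < card (mismatches A f g)"
      by blast
    have "card {s\<in>A. f1 s = c} = card {s\<in>A. g1 s = c}" for c
      using less.prems(3)[of c] swap_step_invariants(2)[OF 1(1) less.prems(1), of "\<lambda>x. x = c"]
        swap_step_invariants(2)[OF 1(2) less.prems(2), of "\<lambda>x. x = c"] by simp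
    from less.hyps[OF 1(3) swap_step_invariants(1)[OF 1(1) less.prems(1)]
        swap_step_invariants(1)[OF 1(2) less.prems(2)] this]
    obtain f' g' where "(swap_step A (rows_ok A blk K Q))\<^sup>*\<^sup>* f1 f'"
        "(swap_step A (rows_ok A blk K Q))\<^sup>*\<^sup>* g1 g'" "\<forall>s\<in>A. f' s = g' s"
      by blast
    then show ?thesis using 1 by (meson rtranclp_trans)
  qed blast
qed

section \<open>Connectivity of assignments with equal edge counts\<close>

context polytree_graph
begin

text \<open>A path from \<open>a\<close> to anything below \<open>z\<close> starts like the path
  from \<open>a\<close> to \<open>z\<close>. Hence rearranging sinks below \<open>z\<close> changes
  nothing at the vertices strictly above \<open>z\<close>.\<close>

lemma child_reaches_iff:
  assumes "(a, c) \<in> E" "a \<preceq> z" "a \<noteq> z" "z \<preceq> x"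
  shows "c \<preceq> x \<longleftrightarrow> c \<preceq> z"
proof
  assume "c \<preceq> x"
  obtain d where d: "(a, d) \<in> E" "d \<preceq> z" using assms reaches_cases by blast
  then have "d \<preceq> x" using assms(4) by (meson rtrancl_trans)
  then show "c \<preceq> z" using child_unique[OF assms(1) d(1) \<open>c \<preceq> x\<close>] d by blast
qed (use assms(4) in \<open>meson rtrancl_trans\<close>)

text \<open>The value \<open>z\<close> encodes that the path stops at \<open>z\<close>; the result is junk unless \<open>z\<close> reaches \<open>x\<close>.\<close>

definition next_step :: "'v \<Rightarrow> 'v \<Rightarrow> 'v" where
  "next_step z x = (if x = z then z else SOME c. (z, c) \<in> E \<and> c \<preceq> x)"

lemma next_step_child:
  assumes "z \<preceq> x" "x \<noteq> z"
  shows "(z, next_step z x) \<in> E" "next_step z x \<preceq> x"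
proof -
  have "\<exists>c. (z, c) \<in> E \<and> c \<preceq> x" using assms reaches_cases by blast
  from someI_ex[OF this] show "(z, next_step z x) \<in> E" "next_step z x \<preceq> x"
    using assms(2) by (simp_all add: next_step_def)
qed

lemma next_step_eq_iff:
  assumes "z \<preceq> x" "(z, c) \<in> E"
  shows "next_step z x = c \<longleftrightarrow> c \<preceq> x"
proof (cases "x = z")
  case True
  then show ?thesis
    using assms not_reaches_parent no_loop by (auto simp: next_step_def)
next
  case False
  then show ?thesis using next_step_child[OF assms(1)] child_unique[OF assms(2)] by blast
qed

end

text \<open>Slots are index positions in the factors of a monomial, \<open>blk\<close> names the
  factor and \<open>tp\<close> its prescribed top. The tops are fixed data, so that an assignment
  varies only in its sinks. The second slot in each block reflects that moments have order at least
  two.\<close>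

locale slot_config = polytree_graph E
  for E :: "('v::{finite,linorder} \<times> 'v) set" +
  fixes Sl :: "'s set" and blk :: "'s \<Rightarrow> 'b" and tp :: "'b \<Rightarrow> 'v"
  assumes finite_slots: "finite Sl"
    and two_slots: "\<And>s. s \<in> Sl \<Longrightarrow> \<exists>t\<in>Sl. t \<noteq> s \<and> blk t = blk s"
begin

definition legal :: "('s \<Rightarrow> 'v) \<Rightarrow> bool" where
  "legal \<sigma> \<longleftrightarrow> (\<forall>s\<in>Sl. tp (blk s) \<preceq> \<sigma> s) \<and>
     (\<forall>b\<in>blk ` Sl. \<forall>c. (tp b, c) \<in> E \<longrightarrow> (\<exists>s\<in>Sl. blk s = b \<and> \<not> c \<preceq> \<sigma> s))"

abbreviation steps :: "('s \<Rightarrow> 'v) \<Rightarrow> ('s \<Rightarrow> 'v) \<Rightarrow> bool" where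
  "steps \<equiv> (swap_step Sl legal)\<^sup>*\<^sup>*"

lemma legal_steps: "steps \<sigma> \<tau> \<Longrightarrow> legal \<sigma> \<Longrightarrow> legal \<tau>"
  by (rule swap_step_invariants(1))

definition through :: "'v \<Rightarrow> ('s \<Rightarrow> 'v) \<Rightarrow> 's set" where
  "through z \<sigma> = {s\<in>Sl. tp (blk s) \<preceq> z \<and> z \<preceq> \<sigma> s}"

text \<open>The assignment \<open>\<sigma>\<close> enters only through its set of slots passing
  \<open>z\<close>, which stays the same during all exchanges at \<open>z\<close>.\<close>

abbreviation ok_at :: "'v \<Rightarrow> ('s \<Rightarrow> 'v) \<Rightarrow> ('s \<Rightarrow> 'v) \<Rightarrow> bool" where
  "ok_at z \<sigma> \<equiv> rows_ok (through z \<sigma>) blk {b\<in>blk ` Sl. tp b = z} {c. (z, c) \<in> E}"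

lemma legal_imp_ok_at:
  assumes "legal \<sigma>"
  shows "ok_at z \<sigma> (next_step z \<circ> \<sigma>)"
  unfolding rows_ok_def
proof (intro ballI)
  fix b q assume b: "b \<in> {b\<in>blk ` Sl. tp b = z}" and q: "q \<in> {c. (z, c) \<in> E}"
  then obtain s where s: "s \<in> Sl" "blk s = b" "\<not> q \<preceq> \<sigma> s"
    using assms unfolding legal_def by blast
  then have "z \<preceq> \<sigma> s" using assms b unfolding legal_def by blast
  then show "\<exists>s\<in>through z \<sigma>. blk s = b \<and> (next_step z \<circ> \<sigma>) s \<noteq> q"
    using s b q next_step_eq_iff by (intro bexI[of _ s]) (auto simp: through_def)
qed

text \<open>A symbol at \<open>z\<close> is exchanged by exchanging the whole sinks behind it. For
  blocks with top \<open>z\<close> legality is exactly \<open>ok_at\<close>; for the other blocks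
  with a slot passing \<open>z\<close> it follows from \<open>child_reaches_iff\<close>.\<close>

lemma lift_steps:
  assumes "legal \<sigma>"
    and "(swap_step (through z \<sigma>) (ok_at z \<sigma>))\<^sup>*\<^sup>* (next_step z \<circ> \<sigma>) f"
  shows "\<exists>\<tau>. steps \<sigma> \<tau> \<and> f = next_step z \<circ> \<tau> \<and> legal \<tau> \<and>
    (\<forall>s\<in>through z \<sigma>. z \<preceq> \<tau> s) \<and> (\<forall>s. s \<notin> through z \<sigma> \<longrightarrow> \<tau> s = \<sigma> s)"
  using assms(2)
proof (induction rule: rtranclp_induct)
  case base
  show ?case using assms(1) by (intro exI[of _ \<sigma>]) (auto simp: through_def)
next
  case (step f f')
  let ?A = "through z \<sigma>"
  obtain \<tau> where \<tau>: "steps \<sigma> \<tau>" "f = next_step z \<circ> \<tau>" "legal \<tau>"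
      "\<And>s. s \<in> ?A \<Longrightarrow> z \<preceq> \<tau> s" "\<And>s. s \<notin> ?A \<Longrightarrow> \<tau> s = \<sigma> s"
    using step.IH by blast
  obtain s t where st: "s \<in> ?A" "t \<in> ?A" "f' = f \<circ> exchange s t" "ok_at z \<sigma> f'"
    using step.hyps(2) unfolding swap_step_def by blast
  let ?\<tau> = "\<tau> \<circ> exchange s t"
  have f': "f' = next_step z \<circ> ?\<tau>" using st(3) \<tau>(2) by (simp add: comp_assoc)
  have stSl: "s \<in> Sl" "t \<in> Sl" using st by (auto simp: through_def)
  have below: "z \<preceq> ?\<tau> x" if "x \<in> ?A" for x
    using \<tau>(4) that st by (cases "x = s"; cases "x = t") auto
  have other: "?\<tau> x = \<tau> x" if "x \<notin> ?A" for x
    using that st by (cases "x = s"; cases "x = t") auto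
  have "legal ?\<tau>"
    unfolding legal_def
  proof (intro conjI ballI allI impI)
    fix x assume x: "x \<in> Sl"
    show "tp (blk x) \<preceq> ?\<tau> x"
    proof (cases "x \<in> ?A")
      case True
      then have "tp (blk x) \<preceq> z" by (simp add: through_def)
      then show ?thesis using below[OF True] by (rule rtrancl_trans)
    next
      case False
      then show ?thesis using other[OF False] \<tau>(3) x unfolding legal_def by simp
    qed
  next
    fix b c assume b: "b \<in> blk ` Sl" and c: "(tp b, c) \<in> E"
    show "\<exists>x\<in>Sl. blk x = b \<and> \<not> c \<preceq> ?\<tau> x"
    proof (cases "tp b = z")
      case True
      then obtain x where x: "x \<in> ?A" "blk x = b" "f' x \<noteq> c"
        using st(4) b c unfolding rows_ok_def by blast
      then have "\<not> c \<preceq> ?\<tau> x"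
        using next_step_eq_iff[OF below[OF x(1)], of c] c True f' by simp
      then show ?thesis using x by (auto simp: through_def)
    next
      case False
      obtain x where x: "x \<in> Sl" "blk x = b" "\<not> c \<preceq> \<tau> x"
        using \<tau>(3) b c unfolding legal_def by blast
      have "\<not> c \<preceq> ?\<tau> x"
      proof (cases "x \<in> ?A")
        case True
        then have "tp b \<preceq> z" using x by (simp add: through_def)
        then show ?thesis
          using child_reaches_iff[OF c _ False \<tau>(4)[OF True]]
            child_reaches_iff[OF c _ False below[OF True]] x(3) by blast
      next
        case out: False
        then show ?thesis using other x by simp
      qed
      then show ?thesis using x by blast
    qed
  qed
  moreover from this have "swap_step Sl legal \<tau> ?\<tau>"
    unfolding swap_step_def using stSl by blast
  then have "steps \<sigma> ?\<tau>" using \<tau>(1) by simp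
  moreover have "\<forall>x. x \<notin> ?A \<longrightarrow> ?\<tau> x = \<sigma> x" using other \<tau>(5) by simp
  ultimately show ?case using f' below by blast
qed

text \<open>Since the tops are fixed, counting sinks beyond an edge amounts to counting the paths through it.\<close>

definition same_counts :: "('s \<Rightarrow> 'v) \<Rightarrow> ('s \<Rightarrow> 'v) \<Rightarrow> bool" where
  "same_counts \<sigma> \<sigma>' \<longleftrightarrow>
     (\<forall>(u, v)\<in>E. card {s\<in>Sl. side u v (\<sigma> s)} = card {s\<in>Sl. side u v (\<sigma>' s)})"

text \<open>Immediate in the form with sides: an exchange merely permutes the values of an
  assignment, whichever tops belong to the slots.\<close>

lemma same_counts_steps:
  assumes "same_counts \<sigma> \<sigma>'" "legal \<sigma>" "legal \<sigma>'" "steps \<sigma> \<tau>" "steps \<sigma>' \<tau>'"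
  shows "same_counts \<tau> \<tau>'"
  using assms swap_step_invariants(2)[OF assms(4,2)] swap_step_invariants(2)[OF assms(5,3)]
  unfolding same_counts_def by simp

lemma card_through_child:
  assumes "legal \<sigma>" "(u, v) \<in> E"
  shows "card {s\<in>Sl. side u v (\<sigma> s)} =
    card {s\<in>Sl. tp (blk s) \<preceq> u \<and> v \<preceq> \<sigma> s} + card {s\<in>Sl. side u v (tp (blk s))}"
proof -
  have "{s\<in>Sl. side u v (\<sigma> s)} =
      {s\<in>Sl. tp (blk s) \<preceq> u \<and> v \<preceq> \<sigma> s} \<union> {s\<in>Sl. side u v (tp (blk s))}"
    using assms crosses_iff_side[OF assms(2)] side_mono[OF assms(2)]
    unfolding legal_def by blast
  moreover have "{s\<in>Sl. tp (blk s) \<preceq> u \<and> v \<preceq> \<sigma> s} \<inter> {s\<in>Sl. side u v (tp (blk s))} = {}"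
    using side_above[OF assms(2)] by blast
  ultimately show ?thesis using finite_slots by (simp add: card_Un_disjoint)
qed

lemma same_counts_iff:
  assumes "legal \<sigma>" "legal \<sigma>'"
  shows "same_counts \<sigma> \<sigma>' \<longleftrightarrow> (\<forall>(u, v)\<in>E. card {s\<in>Sl. tp (blk s) \<preceq> u \<and> v \<preceq> \<sigma> s} =
    card {s\<in>Sl. tp (blk s) \<preceq> u \<and> v \<preceq> \<sigma>' s})"
  unfolding same_counts_def using card_through_child[OF assms(1)] card_through_child[OF assms(2)]
  by fastforce

text \<open>Both assignments use the same outgoing edges at the vertices of \<open>U\<close>. The
  restriction to vertices below the top is what turns reaching \<open>c\<close> into passing through
  the edge from \<open>u\<close> to \<open>c\<close>.\<close>

definition agree :: "'v set \<Rightarrow> ('s \<Rightarrow> 'v) \<Rightarrow> ('s \<Rightarrow> 'v) \<Rightarrow> bool" where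
  "agree U \<sigma> \<sigma>' \<longleftrightarrow> (\<forall>s\<in>Sl. \<forall>u\<in>U. \<forall>c. (u, c) \<in> E \<longrightarrow> tp (blk s) \<preceq> u \<longrightarrow> (c \<preceq> \<sigma> s \<longleftrightarrow> c \<preceq> \<sigma>' s))"

text \<open>Unless its top is \<open>z\<close>, a path enters \<open>z\<close> through a parent of
  \<open>z\<close>, where the two assignments already agree.\<close>

lemma agree_through:
  assumes "agree U \<sigma> \<sigma>'" "legal \<sigma>" "legal \<sigma>'" "\<And>u. (u, z) \<in> E \<Longrightarrow> u \<in> U"
  shows "through z \<sigma> = through z \<sigma>'"
proof -
  have "z \<preceq> \<sigma> s \<longleftrightarrow> z \<preceq> \<sigma>' s" if s: "s \<in> Sl" "tp (blk s) \<preceq> z" for s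
    using s(2)
  proof (cases rule: rtranclE)
    case base
    then have "z \<preceq> \<sigma> s" "z \<preceq> \<sigma>' s" using assms(2,3) s(1) unfolding legal_def by blast+
    then show ?thesis by blast
  next
    case (step u)
    then show ?thesis using assms(1,4) s unfolding agree_def by blast
  qed
  then show ?thesis unfolding through_def by blast
qed

text \<open>For a child this is the number of paths through an edge. The only other symbol, stopping
  at \<open>z\<close>, receives what is left of the common total.\<close>

lemma card_next_step:
  assumes "legal \<sigma>" "legal \<sigma>'" "same_counts \<sigma> \<sigma>'" "through z \<sigma> = through z \<sigma>'"
  shows "card {s\<in>through z \<sigma>. next_step z (\<sigma> s) = c} =
    card {s\<in>through z \<sigma>. next_step z (\<sigma>' s) = c}"
proof -
  let ?A = "through z \<sigma>" and ?C = "{c. (z, c) \<in> E}"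
  have fin: "finite ?A" using finite_slots by (simp add: through_def)
  have A: "z \<preceq> \<sigma> s" "z \<preceq> \<sigma>' s" if "s \<in> ?A" for s
    using that assms(4) by (auto simp: through_def)
  have child: "card {s\<in>?A. next_step z (\<sigma> s) = c} = card {s\<in>?A. next_step z (\<sigma>' s) = c}"
    if c: "c \<in> ?C" for c
  proof -
    have zc: "(z, c) \<in> E" using c by simp
    have down: "z \<preceq> x" if "c \<preceq> x" for x
      using zc that by (rule converse_rtrancl_into_rtrancl)
    have "{s\<in>through z \<tau>. next_step z (\<tau> s) = c} = {s\<in>Sl. tp (blk s) \<preceq> z \<and> c \<preceq> \<tau> s}" for \<tau>
      using next_step_eq_iff[OF _ zc] down unfolding through_def by blast
    from this[of \<sigma>] this[of \<sigma>']
    have "{s\<in>?A. next_step z (\<sigma> s) = c} = {s\<in>Sl. tp (blk s) \<preceq> z \<and> c \<preceq> \<sigma> s}"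
        "{s\<in>?A. next_step z (\<sigma>' s) = c} = {s\<in>Sl. tp (blk s) \<preceq> z \<and> c \<preceq> \<sigma>' s}"
      using assms(4) by simp_all
    then show ?thesis
      using zc assms(3) unfolding same_counts_iff[OF assms(1,2)] by auto
  qed
  have split: "card ?A = card {s\<in>?A. next_step z (\<tau> s) = z} + (\<Sum>c\<in>?C. card {s\<in>?A. next_step z (\<tau> s) = c})"
    if \<tau>: "\<And>s. s \<in> ?A \<Longrightarrow> z \<preceq> \<tau> s" for \<tau>
  proof -
    have "next_step z (\<tau> s) \<in> insert z ?C" if "s \<in> ?A" for s
      using next_step_child(1)[OF \<tau>[OF that]] by (cases "\<tau> s = z") (auto simp: next_step_def)
    then have "(\<lambda>s. next_step z (\<tau> s)) ` ?A \<subseteq> insert z ?C" by blast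
    then have "card ?A = (\<Sum>c\<in>insert z ?C. card {s\<in>?A. next_step z (\<tau> s) = c})"
      using sum.group[OF fin, of "insert z ?C" "\<lambda>s. next_step z (\<tau> s)" "\<lambda>_. 1::nat"] by auto
    then show ?thesis using no_loop by simp
  qed
  show ?thesis
  proof (cases "c \<in> ?C")
    case False
    show ?thesis
    proof (cases "c = z")
      case True
      have "(\<Sum>c\<in>?C. card {s\<in>?A. next_step z (\<sigma> s) = c}) = (\<Sum>c\<in>?C. card {s\<in>?A. next_step z (\<sigma>' s) = c})"
        using child by (rule sum.cong[OF refl])
      then show ?thesis using split[of \<sigma>] split[of \<sigma>'] A True by simp
    next
      case neq: False
      have "next_step z (\<tau> s) \<noteq> c" if "z \<preceq> \<tau> s" for \<tau> :: "'s \<Rightarrow> 'v" and s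
        using next_step_child(1)[OF that] False neq by (cases "\<tau> s = z") (auto simp: next_step_def)
      then show ?thesis using A by (metis (mono_tags, lifting) Collect_cong)
    qed
  qed (rule child)
qed

lemma agree_extend:
  assumes ag: "agree U \<sigma> \<sigma>'" and leg: "legal \<sigma>" "legal \<sigma>'" and cnt: "same_counts \<sigma> \<sigma>'"
    and up: "\<And>a b. a \<preceq> b \<Longrightarrow> b \<in> U \<Longrightarrow> a \<in> U"
    and z: "z \<notin> U" "\<And>u. (u, z) \<in> E \<Longrightarrow> u \<in> U"
  shows "\<exists>\<tau> \<tau>'. steps \<sigma> \<tau> \<and> steps \<sigma>' \<tau>' \<and> agree (insert z U) \<tau> \<tau>'"
proof -
  let ?A = "through z \<sigma>" and ?K = "{b\<in>blk ` Sl. tp b = z}" and ?C = "{c. (z, c) \<in> E}"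
  have A': "through z \<sigma>' = ?A" using agree_through[OF ag leg z(2)] by simp
  have "\<exists>f' g'. (swap_step ?A (ok_at z \<sigma>))\<^sup>*\<^sup>* (next_step z \<circ> \<sigma>) f' \<and>
     (swap_step ?A (ok_at z \<sigma>))\<^sup>*\<^sup>* (next_step z \<circ> \<sigma>') g' \<and> (\<forall>s\<in>?A. f' s = g' s)"
  proof (rule rows_ok_connected)
    show "finite ?A" using finite_slots by (simp add: through_def)
    show "ok_at z \<sigma> (next_step z \<circ> \<sigma>)" "ok_at z \<sigma> (next_step z \<circ> \<sigma>')"
      using legal_imp_ok_at[OF leg(1), of z] legal_imp_ok_at[OF leg(2), of z] A' by simp_all
    show "card {s\<in>?A. (next_step z \<circ> \<sigma>) s = c} = card {s\<in>?A. (next_step z \<circ> \<sigma>') s = c}" for c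
      using card_next_step[OF leg cnt A'[symmetric]] by simp
    \<comment> \<open>A block with top \<open>z\<close> has all its slots in \<open>?A\<close>, so
      the constrained rows are whole blocks.\<close>
    show "\<exists>t\<in>?A. t \<noteq> s \<and> blk t = blk s" if s: "s \<in> ?A" "blk s \<in> ?K" for s
    proof -
      obtain t where t: "t \<in> Sl" "t \<noteq> s" "blk t = blk s"
        using two_slots s(1) by (auto simp: through_def)
      then have "tp (blk t) = z" using s(2) by simp
      moreover from this have "z \<preceq> \<sigma> t" using leg(1) t(1) unfolding legal_def by blast
      ultimately have "t \<in> ?A" using t(1) by (simp add: through_def)
      then show ?thesis using t by blast
    qed
  qed
  then obtain f where f: "(swap_step ?A (ok_at z \<sigma>))\<^sup>*\<^sup>* (next_step z \<circ> \<sigma>) f"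
    and g: "\<exists>g'. (swap_step ?A (ok_at z \<sigma>))\<^sup>*\<^sup>* (next_step z \<circ> \<sigma>') g' \<and> (\<forall>s\<in>?A. f s = g' s)"
    by blast
  obtain g where g: "(swap_step ?A (ok_at z \<sigma>))\<^sup>*\<^sup>* (next_step z \<circ> \<sigma>') g" "\<And>s. s \<in> ?A \<Longrightarrow> f s = g s"
    using g by blast
  obtain \<tau> where \<tau>: "steps \<sigma> \<tau>" "f = next_step z \<circ> \<tau>" "legal \<tau>"
      "\<And>s. s \<in> ?A \<Longrightarrow> z \<preceq> \<tau> s" "\<And>s. s \<notin> ?A \<Longrightarrow> \<tau> s = \<sigma> s"
    using lift_steps[OF leg(1) f] by blast
  obtain \<tau>' where \<tau>': "steps \<sigma>' \<tau>'" "g = next_step z \<circ> \<tau>'" "legal \<tau>'"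
      "\<And>s. s \<in> ?A \<Longrightarrow> z \<preceq> \<tau>' s" "\<And>s. s \<notin> ?A \<Longrightarrow> \<tau>' s = \<sigma>' s"
    using lift_steps[OF leg(2), of z g] g(1) unfolding A' by blast
  \<comment> \<open>The vertices \<open>u\<close> and \<open>z\<close> lie on one path and are
    therefore comparable. As \<open>U\<close> is closed under ancestors and omits \<open>z\<close>,
    the vertex \<open>u\<close> is strictly above \<open>z\<close>, and its outgoing edge depends on
    \<open>z\<close> alone.\<close>
  have unchanged: "c \<preceq> \<rho>' s \<longleftrightarrow> c \<preceq> \<rho> s"
    if "s \<in> ?A" "u \<in> U" "(u, c) \<in> E" "tp (blk s) \<preceq> u" "z \<preceq> \<rho> s" "z \<preceq> \<rho>' s" for \<rho> \<rho>' s u c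
  proof -
    have *: "c \<preceq> y"
      if xy: "c \<preceq> x" "z \<preceq> x" "z \<preceq> y" for x y
    proof -
      have "tp (blk s) \<preceq> z" using \<open>s \<in> ?A\<close> by (simp add: through_def)
      moreover have "u \<preceq> x" using \<open>(u, c) \<in> E\<close> xy(1) by (rule converse_rtrancl_into_rtrancl)
      ultimately have "u \<preceq> z \<or> z \<preceq> u"
        using interval_linear[OF \<open>tp (blk s) \<preceq> u\<close> _ _ xy(2)] by blast
      then have "u \<preceq> z" "u \<noteq> z" using up \<open>u \<in> U\<close> z(1) by blast+
      then show "c \<preceq> y"
        using child_reaches_iff[OF \<open>(u, c) \<in> E\<close>] xy by blast
    qed
    show ?thesis using *[of "\<rho> s" "\<rho>' s"] *[of "\<rho>' s" "\<rho> s"] that by blast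
  qed
  have "agree (insert z U) \<tau> \<tau>'"
    unfolding agree_def
  proof (intro ballI allI impI)
    fix s u c assume s: "s \<in> Sl" and u: "u \<in> insert z U" and c: "(u, c) \<in> E" and top: "tp (blk s) \<preceq> u"
    show "c \<preceq> \<tau> s \<longleftrightarrow> c \<preceq> \<tau>' s"
    proof (cases "u = z")
      case True
      show ?thesis
      proof (cases "s \<in> ?A")
        case in_A: True
        then show ?thesis
          using next_step_eq_iff[OF \<tau>(4)[OF in_A], of c] next_step_eq_iff[OF \<tau>'(4)[OF in_A], of c]
            g(2)[OF in_A] \<tau>(2) \<tau>'(2) c True by simp
      next
        case out: False
        then have "\<not> z \<preceq> \<sigma> s" "\<not> z \<preceq> \<sigma>' s"
          using s top True A' by (auto simp: through_def)
        moreover have "z \<preceq> x" if "c \<preceq> x" for x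
          using c that unfolding True by (rule converse_rtrancl_into_rtrancl)
        ultimately show ?thesis using \<tau>(5)[OF out] \<tau>'(5)[OF out] by auto
      qed
    next
      case False
      then have "u \<in> U" using u by simp
      then have eq: "c \<preceq> \<sigma> s \<longleftrightarrow> c \<preceq> \<sigma>' s" using ag s c top unfolding agree_def by blast
      show ?thesis
      proof (cases "s \<in> ?A")
        case in_A: True
        then have "z \<preceq> \<sigma> s" "z \<preceq> \<sigma>' s" using A' by (auto simp: through_def)
        then show ?thesis
          using unchanged[OF in_A \<open>u \<in> U\<close> c top] \<tau>(4)[OF in_A] \<tau>'(4)[OF in_A] eq by blast
      next
        case out: False
        then show ?thesis using \<tau>(5)[OF out] \<tau>'(5)[OF out] eq by simp
      qed
    qed
  qed
  then show ?thesis using \<tau>(1) \<tau>'(1) by blast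
qed

text \<open>Testing the passage through \<open>\<sigma> s\<close> and through
  \<open>\<sigma>' s\<close> shows that each sink reaches the other.\<close>

lemma agree_UNIV_imp_eq:
  assumes "agree UNIV \<sigma> \<sigma>'" "legal \<sigma>" "legal \<sigma>'" "s \<in> Sl"
  shows "\<sigma> s = \<sigma>' s"
proof -
  have "v \<preceq> \<sigma> s \<longleftrightarrow> v \<preceq> \<sigma>' s" if "tp (blk s) \<preceq> v" for v
    using agree_through[OF assms(1-3), of v] that assms(4) by (auto simp: through_def)
  moreover have "tp (blk s) \<preceq> \<sigma> s" "tp (blk s) \<preceq> \<sigma>' s"
    using assms unfolding legal_def by blast+
  ultimately show ?thesis using antisym by blast
qed

lemma steps_connected:
  assumes "legal \<sigma>" "legal \<sigma>'" "same_counts \<sigma> \<sigma>'"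
  shows "\<exists>\<tau> \<tau>'. steps \<sigma> \<tau> \<and> steps \<sigma>' \<tau>' \<and> (\<forall>s\<in>Sl. \<tau> s = \<tau>' s)"
proof -
  have "\<exists>\<tau> \<tau>'. steps \<sigma> \<tau> \<and> steps \<sigma>' \<tau>' \<and> (\<forall>s\<in>Sl. \<tau> s = \<tau>' s)"
    if "legal \<sigma>" "legal \<sigma>'" "same_counts \<sigma> \<sigma>'" "agree U \<sigma> \<sigma>'" "\<And>a b. a \<preceq> b \<Longrightarrow> b \<in> U \<Longrightarrow> a \<in> U" for U \<sigma> \<sigma>'
    using that
  proof (induction "card (- U)" arbitrary: U \<sigma> \<sigma>' rule: less_induct)
    case less
    show ?case
    proof (cases "U = UNIV")
      case True
      then show ?thesis using agree_UNIV_imp_eq less.prems by blast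
    next
      case False
      then obtain x where "x \<in> - U" by blast
      then obtain z where z: "z \<in> - U" "\<And>u. (u, z) \<in> E \<Longrightarrow> u \<notin> - U"
        using wfE_min[OF wf_edges(1), of x "- U"] by metis
      have "\<exists>\<tau> \<tau>'. steps \<sigma> \<tau> \<and> steps \<sigma>' \<tau>' \<and> agree (insert z U) \<tau> \<tau>'"
        by (rule agree_extend[OF less.prems(4,1-3)]) (use z less.prems(5) in blast)+
      then obtain \<tau> \<tau>' where st: "steps \<sigma> \<tau>" "steps \<sigma>' \<tau>'" and ag: "agree (insert z U) \<tau> \<tau>'"
        by blast
      have "card (- insert z U) < card (- U)"
        using z(1) by (intro psubset_card_mono) auto
      moreover have "legal \<tau>" "legal \<tau>'"
        using swap_step_invariants(1)[OF st(1) less.prems(1)]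
          swap_step_invariants(1)[OF st(2) less.prems(2)] .
      moreover have "same_counts \<tau> \<tau>'"
        using same_counts_steps[OF less.prems(3,1,2) st] .
      moreover have "a \<in> insert z U" if "a \<preceq> b" "b \<in> insert z U" for a b
      proof (cases "b = z")
        case True
        from that(1) show ?thesis
        proof (cases rule: rtranclE)
          case (step u)
          then have "u \<in> U" using z(2) True by blast
          then show ?thesis using less.prems(5) step(1) by blast
        qed (use True in simp)
      next
        case False
        then show ?thesis using that less.prems(5) by blast
      qed
      ultimately obtain \<rho> \<rho>' where "steps \<tau> \<rho>" "steps \<tau>' \<rho>'" "\<forall>s\<in>Sl. \<rho> s = \<rho>' s"
        using less.hyps[of "insert z U" \<tau> \<tau>'] ag by blast
      then show ?thesis using st by (meson rtranclp_trans)
    qed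
  qed
  from this[of \<sigma> \<sigma>' "{}"] show ?thesis using assms by (simp add: agree_def)
qed

end

section \<open>Congruence of monomials modulo the trek ideal\<close>

text \<open>Allows the factors of two monomials to be listed so that factors in the same position
  have the same order and the same top.\<close>

lemma mset_map_eq_imp_reordering:
  assumes "mset (map f xs) = mset (map f ys)"
  shows "\<exists>zs. mset zs = mset ys \<and> map f zs = map f xs"
  using assms
proof (induction xs arbitrary: ys)
  case (Cons x xs)
  then have "f x \<in># mset (map f ys)" by (metis list.set_intros(1) list.simps(9) set_mset_mset)
  then obtain y where y: "y \<in> set ys" "f y = f x" by auto
  then have ys: "mset ys = add_mset y (mset (remove1 y ys))" by simp
  then have "image_mset f (mset ys) = add_mset (f y) (image_mset f (mset (remove1 y ys)))"
    by (metis image_mset_add_mset)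
  then have "mset (map f xs) = mset (map f (remove1 y ys))"
    using Cons.prems y(2) by (simp only: mset_map list.map mset.simps add_mset_add_mset_same_iff)
  from Cons.IH[OF this] obtain zs where zs: "mset zs = mset (remove1 y ys)" "map f zs = map f xs"
    by blast
  have "mset (y # zs) = mset ys" by (simp only: mset.simps zs(1) ys[symmetric])
  moreover have "map f (y # zs) = map f (x # xs)" using zs(2) y(2) by simp
  ultimately show ?case by blast
qed simp

lemma mset_map_upt_remove:
  assumes "r < k"
  shows "mset (map f [0..<k]) = add_mset (f r) (mset (map f (filter (\<lambda>x. x \<noteq> r) [0..<k])))"
proof -
  have "mset [0..<k] = mset (filter (\<lambda>x. x = r) [0..<k]) + mset (filter (\<lambda>x. x \<noteq> r) [0..<k])"
    by (metis mset_filter multiset_partition)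
  moreover have "filter (\<lambda>x. x = r) [0..<k] = [r]"
  proof -
    have "[0..<k] = [0..<r] @ r # [Suc r..<k]"
      using assms by (metis le0 less_imp_le_nat upt_add_eq_append upt_conv_Cons le_add_diff_inverse)
    then show ?thesis by (simp add: filter_empty_conv)
  qed
  ultimately show ?thesis by simp
qed

text \<open>Treats \<open>s\<close> and \<open>t\<close> variables uniformly and accepts their
  indices in any order, so that a single index can be replaced without sorting.\<close>

definition list_var :: "'v::linorder list \<Rightarrow> 'v moment_poly" where
  "list_var xs = poly_var (Abs_moment_var (sort xs))"

lemma list_var_cong: "mset xs = mset ys \<Longrightarrow> list_var xs = list_var ys"
  by (metis list_var_def sorted_list_of_multiset_mset)

lemma s_var_eq: "s_var i j = list_var [i, j]"
  and t_var_eq: "t_var i j k = list_var [i, j, k]"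
  by (simp_all only: s_var_def t_var_def list_var_def)

lemma Rep_moment_var_props: "sorted (Rep_moment_var x)" "length (Rep_moment_var x) \<in> {2, 3}"
  using Rep_moment_var[of x] by auto

lemma list_var_Rep: "list_var (Rep_moment_var x) = poly_var x"
  using Rep_moment_var_props[of x] by (simp add: list_var_def sorted_sort_id Rep_moment_var_inverse)

lemma Rep_moment_var_sort:
  "length xs \<in> {2, 3} \<Longrightarrow> Rep_moment_var (Abs_moment_var (sort xs)) = sort xs"
  by (auto intro: Abs_moment_var_inverse)

interpretation ring_ideal: module "(*) :: 'a::comm_ring_1 \<Rightarrow> 'a \<Rightarrow> 'a"
  by (rule module_times)

lemma trek_ideal_add: "f \<in> trek_ideal E \<Longrightarrow> g \<in> trek_ideal E \<Longrightarrow> f + g \<in> trek_ideal E"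
  and trek_ideal_diff: "f \<in> trek_ideal E \<Longrightarrow> g \<in> trek_ideal E \<Longrightarrow> f - g \<in> trek_ideal E"
  and trek_ideal_mult: "f \<in> trek_ideal E \<Longrightarrow> h * f \<in> trek_ideal E"
  and trek_ideal_zero: "0 \<in> trek_ideal E"
  by (simp_all only: trek_ideal_def ideal_generated_by_def ring_ideal.span_add ring_ideal.span_diff
      ring_ideal.span_scale ring_ideal.span_zero)

lemma trek_ideal_sum: "(\<And>x. x \<in> A \<Longrightarrow> f x \<in> trek_ideal E) \<Longrightarrow> sum f A \<in> trek_ideal E"
  unfolding trek_ideal_def ideal_generated_by_def by (rule ring_ideal.span_sum)

lemma trek_minor_in_trek_ideal:
  assumes "has_trek E [i, j]" "c \<in> trek_cols E i j" "d \<in> trek_cols E i j"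
  shows "trek_matrix i j 1 c * trek_matrix i j 2 d - trek_matrix i j 1 d * trek_matrix i j 2 c
    \<in> trek_ideal E"
proof (cases "c = d")
  case True
  then show ?thesis by (simp add: trek_ideal_zero)
next
  case False
  have "det (\<chi> r. \<chi> q :: 2. trek_matrix i j r (if q = 1 then c else d)) \<in> trek_minors E i j"
    using assms False unfolding trek_minors_def by blast
  then have "det (\<chi> r. \<chi> q :: 2. trek_matrix i j r (if q = 1 then c else d)) \<in> trek_ideal E"
    using assms(1) unfolding trek_ideal_def ideal_generated_by_def
    by (intro ring_ideal.span_base) blast
  then show ?thesis by (simp add: det_2)
qed

lemma no_trek_in_trek_ideal:
  assumes "\<not> has_trek E (Rep_moment_var x)"
  shows "poly_var x \<in> trek_ideal E"
proof -
  consider i j where "Rep_moment_var x = [i, j]" | i j k where "Rep_moment_var x = [i, j, k]"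
    using Rep_moment_var_props(2)[of x]
    by (auto simp: numeral_2_eq_2 numeral_3_eq_3 length_Suc_conv)
  then show ?thesis
  proof cases
    case 1
    then have "poly_var x = s_var i j" by (metis list_var_Rep s_var_eq)
    then show ?thesis using assms 1 unfolding trek_ideal_def ideal_generated_by_def
      by (intro ring_ideal.span_base) auto
  next
    case 2
    then have "poly_var x = t_var i j k" by (metis list_var_Rep t_var_eq)
    then show ?thesis using assms 2 unfolding trek_ideal_def ideal_generated_by_def
      by (intro ring_ideal.span_base) auto
  qed
qed

section \<open>Minors as exchanges of one index between two moments\<close>

context polytree_graph
begin

lemma trek_col_exists:
  assumes "is_top w (i # c)" "is_top w (j # c)" "length c \<in> {1, 2}"
  shows "\<exists>q\<in>trek_cols E i j. \<forall>r. trek_matrix i j r q = list_var ((if r = 1 then i else j) # c)"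
proof -
  consider k where "c = [k]" | l m where "c = [l, m]"
    using assms(3) by (auto simp: numeral_2_eq_2 length_Suc_conv)
  then show ?thesis
  proof cases
    case 1
    then have "SCol k \<in> trek_cols E i j"
      using assms by (auto simp: trek_cols_def same_top_iff)
    then show ?thesis using 1
      by (intro bexI[of _ "SCol k"]) (simp_all add: trek_matrix_def s_var_eq)
  next
    case 2
    \<comment> \<open>A trek-matrix lists a pair of column indices only in increasing order.\<close>
    define l' m' where "l' = min l m" and "m' = max l m"
    have sets: "set (x # [l', m']) = set (x # c)" and msets: "mset (x # [l', m']) = mset (x # c)" for x
      using 2 by (auto simp: l'_def m'_def min_def max_def)
    have "same_top E i j [l', m']"
      using assms is_top_cong[OF sets] unfolding same_top_iff by blast
    moreover have "l' \<le> m'" by (cases "l \<le> m") (auto simp: l'_def m'_def)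
    ultimately have "TCol l' m' \<in> trek_cols E i j"
      by (auto simp: trek_cols_def)
    moreover have "trek_matrix i j r (TCol l' m') = list_var ((if r = 1 then i else j) # c)" for r
      using list_var_cong[OF msets] by (simp add: trek_matrix_def t_var_eq)
    ultimately show ?thesis by blast
  qed
qed

text \<open>The minor of the matrix of \<open>i\<close>, \<open>j\<close> with columns
  \<open>c\<close>, \<open>d\<close> is an exchange of \<open>i\<close> and \<open>j\<close> between
  two moments. That \<open>c\<close> and \<open>d\<close> are columns means precisely that the
  exchange keeps both tops, which may differ from each other.\<close>

lemma exchange_in_trek_ideal:
  assumes "is_top w (i # c)" "is_top w (j # c)" "length c \<in> {1, 2}"
    and "is_top w' (i # d)" "is_top w' (j # d)" "length d \<in> {1, 2}"
  shows "list_var (i # c) * list_var (j # d) - list_var (j # c) * list_var (i # d) \<in> trek_ideal E"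
proof -
  obtain p where p: "p \<in> trek_cols E i j"
      "\<And>r. trek_matrix i j r p = list_var ((if r = 1 then i else j) # c)"
    using trek_col_exists[OF assms(1-3)] by blast
  obtain q where q: "q \<in> trek_cols E i j"
      "\<And>r. trek_matrix i j r q = list_var ((if r = 1 then i else j) # d)"
    using trek_col_exists[OF assms(4-6)] by blast
  have "has_trek E [i, j]"
    using assms(1,2) unfolding has_trek_iff is_top_def by auto
  from trek_minor_in_trek_ideal[OF this p(1) q(1)] show ?thesis
    by (simp add: p(2) q(2) mult.commute)
qed

end

text \<open>The factors of a monomial are numbered by \<open>b\<close>; the slot
  \<open>(b, r)\<close> is the index in position \<open>r\<close> of factor
  \<open>b\<close>.\<close>

locale block_config = polytree_graph E
  for E :: "('v::{finite,linorder} \<times> 'v) set" +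
  fixes N :: nat and sz :: "nat \<Rightarrow> nat" and tp :: "nat \<Rightarrow> 'v"
  assumes sz: "\<And>b. b < N \<Longrightarrow> sz b \<in> {2, 3}"
begin

abbreviation slots :: "(nat \<times> nat) set" where
  "slots \<equiv> SIGMA b:{..<N}. {..<sz b}"

sublocale slot_config E slots fst tp
proof
  fix s assume "s \<in> slots"
  then obtain b r where s: "s = (b, r)" "b < N" "r < sz b" by auto
  then have "(b, if r = 0 then 1 else 0) \<in> slots" using sz[OF s(2)] by auto
  then show "\<exists>t\<in>slots. t \<noteq> s \<and> fst t = fst s"
    using s by (intro bexI[of _ "(b, if r = 0 then 1 else 0)"]) auto
qed simp

definition block :: "(nat \<times> nat \<Rightarrow> 'v) \<Rightarrow> nat \<Rightarrow> 'v list" where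
  "block \<sigma> b = map (\<lambda>r. \<sigma> (b, r)) [0..<sz b]"

definition config_poly :: "(nat \<times> nat \<Rightarrow> 'v) \<Rightarrow> 'v moment_poly" where
  "config_poly \<sigma> = (\<Prod>b<N. list_var (block \<sigma> b))"

lemma legal_iff: "legal \<sigma> \<longleftrightarrow> (\<forall>b<N. is_top (tp b) (block \<sigma> b))"
proof -
  have mem: "b \<in> fst ` slots \<longleftrightarrow> b < N" for b
  proof
    assume "b < N"
    then have "(b, 0) \<in> slots" using sz[of b] by auto
    then show "b \<in> fst ` slots" by (metis fst_conv imageI)
  qed auto
  have ex: "(\<exists>s\<in>slots. fst s = b \<and> \<not> c \<preceq> \<sigma> s) \<longleftrightarrow> (\<exists>r<sz b. \<not> c \<preceq> \<sigma> (b, r))" if "b < N" for b c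
    using that by auto
  have A: "(\<forall>s\<in>slots. tp (fst s) \<preceq> \<sigma> s) \<longleftrightarrow> (\<forall>b<N. \<forall>r<sz b. tp b \<preceq> \<sigma> (b, r))"
    by auto
  have B: "(\<forall>b\<in>fst ` slots. \<forall>c. (tp b, c) \<in> E \<longrightarrow> (\<exists>s\<in>slots. fst s = b \<and> \<not> c \<preceq> \<sigma> s)) \<longleftrightarrow>
      (\<forall>b<N. \<forall>c. (tp b, c) \<in> E \<longrightarrow> (\<exists>r<sz b. \<not> c \<preceq> \<sigma> (b, r)))"
    unfolding Ball_def[of "fst ` slots"] mem using ex by simp
  show ?thesis
    unfolding legal_def A B is_top_def block_def
    by (auto simp: Ball_def Bex_def)
qed

lemma block_split:
  assumes "(b, r) \<in> slots"
  shows "mset (block \<sigma> b) = mset (\<sigma> (b, r) # map (\<lambda>x. \<sigma> (b, x)) (filter (\<lambda>x. x \<noteq> r) [0..<sz b]))"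
  using assms mset_map_upt_remove[of r "sz b" "\<lambda>x. \<sigma> (b, x)"] by (simp add: block_def)

lemma length_block_rest:
  assumes "(b, r) \<in> slots"
  shows "length (map f (filter (\<lambda>x. x \<noteq> r) [0..<sz b])) \<in> {1, 2}"
proof -
  define n where "n = length (map f (filter (\<lambda>x. x \<noteq> r) [0..<sz b]))"
  have "r < sz b" using assms by simp
  from arg_cong[OF mset_map_upt_remove[OF this, of f], of size]
  have "length (map f [0..<sz b]) = Suc n"
    unfolding n_def by (simp only: size_mset size_add_mset)
  then have "n \<in> {1, 2}" using sz[of b] assms by auto
  then show ?thesis by (simp only: n_def)
qed

lemma mset_block_exchange_same:
  assumes "(b, r) \<in> slots" "(b, r') \<in> slots"
  shows "mset (block (\<sigma> \<circ> exchange (b, r) (b, r')) a) = mset (block \<sigma> a)"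
proof (cases "a = b")
  case True
  have "exchange (b, r) (b, r') (b, x) = (b, exchange r r' x)" for x
    by (simp add: exchange_def)
  then have "mset (block (\<sigma> \<circ> exchange (b, r) (b, r')) b) =
      image_mset (\<lambda>x. \<sigma> (b, exchange r r' x)) (mset_set {0..<sz b})"
    by (simp add: block_def)
  also have "\<dots> = image_mset (\<lambda>x. \<sigma> (b, x)) (image_mset (exchange r r') (mset_set {0..<sz b}))"
    by (simp add: image_mset.compositionality comp_def)
  also have "image_mset (exchange r r') (mset_set {0..<sz b}) = mset_set {0..<sz b}"
    using assms by (simp add: image_mset_mset_set)
  finally show ?thesis using True by (simp add: block_def)
next
  case False
  then have "block (\<sigma> \<circ> exchange (b, r) (b, r')) a = block \<sigma> a"
    by (simp add: block_def)
  then show ?thesis by simp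
qed

text \<open>Inside one factor an exchange only permutes symmetric indices. Between two factors the
  difference is a minor times the product of the remaining factors.\<close>

lemma config_poly_exchange:
  assumes "legal \<sigma>" "legal (\<sigma> \<circ> exchange s t)" "s \<in> slots" "t \<in> slots"
  shows "config_poly \<sigma> - config_poly (\<sigma> \<circ> exchange s t) \<in> trek_ideal E"
proof -
  obtain b r where s: "s = (b, r)" by (cases s)
  obtain b' r' where t: "t = (b', r')" by (cases t)
  let ?\<sigma>' = "\<sigma> \<circ> exchange s t"
  show ?thesis
  proof (cases "b = b'")
    case True
    then have "list_var (block ?\<sigma>' a) = list_var (block \<sigma> a)" for a
      using mset_block_exchange_same assms(3,4) s t by (intro list_var_cong) simp
    then show ?thesis by (simp add: config_poly_def trek_ideal_zero)
  next
    case False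
    have N: "b < N" "b' < N" using assms(3,4) s t by auto
    define c where "c = map (\<lambda>x. \<sigma> (b, x)) (filter (\<lambda>x. x \<noteq> r) [0..<sz b])"
    define d where "d = map (\<lambda>x. \<sigma> (b', x)) (filter (\<lambda>x. x \<noteq> r') [0..<sz b'])"
    have c': "map (\<lambda>x. ?\<sigma>' (b, x)) (filter (\<lambda>x. x \<noteq> r) [0..<sz b]) = c"
      and d': "map (\<lambda>x. ?\<sigma>' (b', x)) (filter (\<lambda>x. x \<noteq> r') [0..<sz b']) = d"
      using False by (auto simp: c_def d_def s t)
    have b: "mset (block \<sigma> b) = mset (\<sigma> s # c)"
      using block_split[of b r \<sigma>] assms(3) unfolding s c_def by blast
    have "mset (block ?\<sigma>' b) = mset (?\<sigma>' s # c)"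
      using block_split[of b r ?\<sigma>'] assms(3) c' unfolding s by metis
    then have b2: "mset (block ?\<sigma>' b) = mset (\<sigma> t # c)" by simp
    have b': "mset (block \<sigma> b') = mset (\<sigma> t # d)"
      using block_split[of b' r' \<sigma>] assms(4) unfolding t d_def by blast
    have "mset (block ?\<sigma>' b') = mset (?\<sigma>' t # d)"
      using block_split[of b' r' ?\<sigma>'] assms(4) d' unfolding t by metis
    then have b2': "mset (block ?\<sigma>' b') = mset (\<sigma> s # d)" by simp
    have other: "block ?\<sigma>' a = block \<sigma> a" if "a \<noteq> b" "a \<noteq> b'" for a
      using that by (simp add: block_def s t)
    have "is_top (tp b) (\<sigma> s # c)" "is_top (tp b) (\<sigma> t # c)"
        "is_top (tp b') (\<sigma> s # d)" "is_top (tp b') (\<sigma> t # d)"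
      using assms(1,2) N b b' b2 b2' unfolding legal_iff by (metis is_top_cong mset_eq_setD)+
    then have swap: "list_var (\<sigma> s # c) * list_var (\<sigma> t # d) -
        list_var (\<sigma> t # c) * list_var (\<sigma> s # d) \<in> trek_ideal E"
      using length_block_rest[of b r] length_block_rest[of b' r'] assms(3,4)
      unfolding s t c_def d_def by (intro exchange_in_trek_ideal) blast+
    have split: "config_poly \<rho> = list_var (block \<rho> b) * list_var (block \<rho> b') *
        (\<Prod>a\<in>{..<N} - {b, b'}. list_var (block \<rho> a))" for \<rho>
    proof -
      have "config_poly \<rho> = list_var (block \<rho> b) * (\<Prod>a\<in>{..<N} - {b}. list_var (block \<rho> a))"
        unfolding config_poly_def using N by (intro prod.remove) simp_all
      also have "(\<Prod>a\<in>{..<N} - {b}. list_var (block \<rho> a)) =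
          list_var (block \<rho> b') * (\<Prod>a\<in>{..<N} - {b} - {b'}. list_var (block \<rho> a))"
        using N False by (intro prod.remove) simp_all
      also have "{..<N} - {b} - {b'} = {..<N} - {b, b'}" by blast
      finally show ?thesis by (simp only: mult.assoc)
    qed
    let ?P = "\<Prod>a\<in>{..<N} - {b, b'}. list_var (block \<sigma> a)"
    have "(\<Prod>a\<in>{..<N} - {b, b'}. list_var (block ?\<sigma>' a)) = ?P"
      using other by (intro prod.cong) auto
    then have "config_poly \<sigma> - config_poly ?\<sigma>' = ?P * (list_var (\<sigma> s # c) * list_var (\<sigma> t # d) -
        list_var (\<sigma> t # c) * list_var (\<sigma> s # d))"
      unfolding split[of \<sigma>] split[of ?\<sigma>']
        list_var_cong[OF b] list_var_cong[OF b2] list_var_cong[OF b'] list_var_cong[OF b2']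
      by (simp only: algebra_simps)
    then show ?thesis using trek_ideal_mult[OF swap] by simp
  qed
qed

lemma config_poly_steps:
  assumes "legal \<sigma>" "steps \<sigma> \<tau>"
  shows "config_poly \<sigma> - config_poly \<tau> \<in> trek_ideal E"
  using assms(2)
proof (induction rule: rtranclp_induct)
  case base
  show ?case by (simp add: trek_ideal_zero)
next
  case (step \<tau> \<rho>)
  obtain s t where st: "s \<in> slots" "t \<in> slots" "\<rho> = \<tau> \<circ> exchange s t" "legal \<rho>"
    by (rule swap_stepE[OF step.hyps(2)])
  have "legal \<tau>" by (rule legal_steps[OF step.hyps(1) assms(1)])
  then have "config_poly \<tau> - config_poly \<rho> \<in> trek_ideal E"
    using config_poly_exchange[of \<tau> s t] st by simp
  from trek_ideal_add[OF step.IH this] show ?case by simp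
qed

lemma config_poly_same_counts:
  assumes "legal \<sigma>" "legal \<sigma>'" "same_counts \<sigma> \<sigma>'"
  shows "config_poly \<sigma> - config_poly \<sigma>' \<in> trek_ideal E"
proof -
  obtain \<tau> \<tau>' where st: "steps \<sigma> \<tau>" "steps \<sigma>' \<tau>'" and eq: "\<forall>s\<in>slots. \<tau> s = \<tau>' s"
    using steps_connected[OF assms] by blast
  have "block \<tau> b = block \<tau>' b" if "b < N" for b
    using eq that by (auto simp: block_def)
  then have "config_poly \<tau> = config_poly \<tau>'"
    by (simp add: config_poly_def)
  moreover have "(config_poly \<sigma> - config_poly \<tau>) - (config_poly \<sigma>' - config_poly \<tau>') \<in> trek_ideal E"
    by (rule trek_ideal_diff[OF config_poly_steps[OF assms(1) st(1)] config_poly_steps[OF assms(2) st(2)]])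
  ultimately show ?thesis by simp
qed

end

section \<open>From monomials to assignments of sinks\<close>

context polytree_graph
begin

abbreviation var_top :: "'v moment_var \<Rightarrow> 'v" where
  "var_top x \<equiv> trek_top E (Rep_moment_var x)"

abbreviation live :: "'v moment_var \<Rightarrow> bool" where
  "live x \<equiv> has_trek E (Rep_moment_var x)"

lemma Rep_moment_var_ne_Nil: "Rep_moment_var x \<noteq> []"
  using Rep_moment_var_props(2)[of x] by auto

lemma is_top_var_top: "live x \<Longrightarrow> is_top (var_top x) (Rep_moment_var x)"
  using trek_top_eq[OF Rep_moment_var_ne_Nil] unfolding has_trek_iff_is_top by metis

text \<open>For an edge and a live variable, this is the exponent of the edge weight in the
  parametrized moment.\<close>

definition edge_count :: "'v \<Rightarrow> 'v \<Rightarrow> 'v moment_var \<Rightarrow> nat" where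
  "edge_count u v x =
     (if var_top x \<preceq> u then length (filter (\<lambda>i. v \<preceq> i) (Rep_moment_var x)) else 0)"

lemma prod_list_poly_var_congruent:
  assumes live: "\<forall>x\<in>set L. live x" "\<forall>x\<in>set L'. live x"
    and kind: "map (\<lambda>x. (var_top x, length (Rep_moment_var x))) L =
      map (\<lambda>x. (var_top x, length (Rep_moment_var x))) L'"
    and cnt: "\<And>u v. (u, v) \<in> E \<Longrightarrow> (\<Sum>x\<leftarrow>L. edge_count u v x) = (\<Sum>x\<leftarrow>L'. edge_count u v x)"
  shows "(\<Prod>x\<leftarrow>L. poly_var x) - (\<Prod>x\<leftarrow>L'. poly_var x) \<in> trek_ideal E"
proof -
  \<comment> \<open>Read off \<open>L\<close>. By \<open>kind\<close> the same data describe
    \<open>L'\<close>, so both products are assignments for one configuration.\<close>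
  define sz where "sz = (\<lambda>b. length (Rep_moment_var (L ! b)))"
  define tp where "tp = (\<lambda>b. var_top (L ! b))"
  define conf where "conf = (\<lambda>M (b, r). Rep_moment_var (M ! b :: 'v moment_var) ! r)"
  have len: "length L = length L'" using kind map_eq_imp_length_eq by blast
  interpret block_config E "length L" sz tp
    by unfold_locales (use Rep_moment_var_props(2) in \<open>simp add: sz_def\<close>)
  have kinds: "var_top (L' ! b) = tp b \<and> length (Rep_moment_var (L' ! b)) = sz b" if "b < length L" for b
    using arg_cong[OF kind, of "\<lambda>xs. xs ! b"] that len by (simp add: sz_def tp_def)
  have *: "legal (conf M) \<and> config_poly (conf M) = (\<Prod>x\<leftarrow>M. poly_var x) \<and>
      (\<forall>u v. card {s\<in>slots. tp (fst s) \<preceq> u \<and> v \<preceq> conf M s} = (\<Sum>x\<leftarrow>M. edge_count u v x))"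
    if M: "\<And>b. b < length L \<Longrightarrow> var_top (M ! b) = tp b \<and> length (Rep_moment_var (M ! b)) = sz b"
      "length M = length L" "\<forall>x\<in>set M. live x" for M
  proof (intro conjI allI)
    have block: "block (conf M) b = Rep_moment_var (M ! b)" if "b < length L" for b
      using M(1)[OF that] by (intro nth_equalityI) (auto simp: block_def conf_def)
    show "legal (conf M)"
      unfolding legal_iff
    proof (intro allI impI)
      fix b assume b: "b < length L"
      then have "live (M ! b)" using M(2,3) by simp
      from is_top_var_top[OF this] show "is_top (tp b) (block (conf M) b)"
        using block[OF b] M(1)[OF b] by simp
    qed
    show "config_poly (conf M) = (\<Prod>x\<leftarrow>M. poly_var x)"
      unfolding config_poly_def prod.list_conv_set_nth atLeast0LessThan using M(2)
      by (intro prod.cong) (auto simp: block list_var_Rep)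
    fix u v
    have "{s\<in>slots. tp (fst s) \<preceq> u \<and> v \<preceq> conf M s} =
        (SIGMA b:{..<length L}. {r\<in>{..<sz b}. tp b \<preceq> u \<and> v \<preceq> conf M (b, r)})"
      by auto
    then have "card {s\<in>slots. tp (fst s) \<preceq> u \<and> v \<preceq> conf M s} =
        (\<Sum>b<length L. card {r\<in>{..<sz b}. tp b \<preceq> u \<and> v \<preceq> conf M (b, r)})"
      by (simp add: card_SigmaI)
    also have "\<dots> = (\<Sum>b<length L. edge_count u v (M ! b))"
    proof (rule sum.cong[OF refl])
      fix b assume "b \<in> {..<length L}"
      then have b: "b < length L" by simp
      show "card {r\<in>{..<sz b}. tp b \<preceq> u \<and> v \<preceq> conf M (b, r)} = edge_count u v (M ! b)"
        using M(1)[OF b] by (auto simp: edge_count_def length_filter_conv_card conf_def)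
    qed
    also have "\<dots> = (\<Sum>x\<leftarrow>M. edge_count u v x)"
      using M(2) by (simp add: sum_list_sum_nth atLeast0LessThan)
    finally show "card {s\<in>slots. tp (fst s) \<preceq> u \<and> v \<preceq> conf M s} = (\<Sum>x\<leftarrow>M. edge_count u v x)" .
  qed
  have L: "legal (conf L)" "config_poly (conf L) = (\<Prod>x\<leftarrow>L. poly_var x)"
      "\<And>u v. card {s\<in>slots. tp (fst s) \<preceq> u \<and> v \<preceq> conf L s} = (\<Sum>x\<leftarrow>L. edge_count u v x)"
    using *[of L] live(1) by (auto simp: sz_def tp_def)
  have L': "legal (conf L')" "config_poly (conf L') = (\<Prod>x\<leftarrow>L'. poly_var x)"
      "\<And>u v. card {s\<in>slots. tp (fst s) \<preceq> u \<and> v \<preceq> conf L' s} = (\<Sum>x\<leftarrow>L'. edge_count u v x)"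
    using *[OF kinds len[symmetric] live(2)] by blast+
  have "same_counts (conf L) (conf L')"
    unfolding same_counts_iff[OF L(1) L'(1)] L(3) L'(3) using cnt by blast
  from config_poly_same_counts[OF L(1) L'(1) this] show ?thesis
    using L(2) L'(2) by simp
qed

end

section \<open>Evaluation and degrees\<close>

definition monomial_eval :: "('a \<Rightarrow> 'b::comm_semiring_1) \<Rightarrow> ('a \<Rightarrow>\<^sub>0 nat) \<Rightarrow> 'b" where
  "monomial_eval \<xi> m = (\<Prod>x\<in>Poly_Mapping.keys m. \<xi> x ^ Poly_Mapping.lookup m x)"

lemma monomial_eval_superset:
  assumes "finite S" "Poly_Mapping.keys m \<subseteq> S"
  shows "monomial_eval \<xi> m = (\<Prod>x\<in>S. \<xi> x ^ Poly_Mapping.lookup m x)"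
  unfolding monomial_eval_def using assms
  by (intro prod.mono_neutral_left) (auto simp: not_in_keys_iff_lookup_eq_zero)

lemma monomial_eval_add: "monomial_eval \<xi> (m + m') = monomial_eval \<xi> m * monomial_eval \<xi> m'"
proof -
  let ?S = "Poly_Mapping.keys m \<union> Poly_Mapping.keys m'"
  have "Poly_Mapping.keys (m + m') \<subseteq> ?S" by (rule keys_add)
  then show ?thesis
    by (simp add: monomial_eval_superset[of ?S] lookup_add power_add prod.distrib)
qed

lemma monomial_eval_single: "monomial_eval \<xi> (Poly_Mapping.single x n) = \<xi> x ^ n"
  by (simp add: monomial_eval_def)

lemma poly_eval_superset:
  assumes "finite S" "Poly_Mapping.keys f \<subseteq> S"
  shows "poly_eval \<xi> f = (\<Sum>m\<in>S. Poly_Mapping.lookup f m * monomial_eval \<xi> m)"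
  unfolding poly_eval_def monomial_eval_def[symmetric] using assms
  by (intro sum.mono_neutral_left) (auto simp: not_in_keys_iff_lookup_eq_zero)

lemma poly_eval_zero: "poly_eval \<xi> 0 = 0"
  by (simp add: poly_eval_def)

lemma poly_eval_add: "poly_eval \<xi> (f + g) = poly_eval \<xi> f + poly_eval \<xi> g"
proof -
  let ?S = "Poly_Mapping.keys f \<union> Poly_Mapping.keys g"
  have "Poly_Mapping.keys (f + g) \<subseteq> ?S" by (rule keys_add)
  then show ?thesis
    by (simp add: poly_eval_superset[of ?S] lookup_add algebra_simps sum.distrib)
qed

lemma poly_eval_sum: "poly_eval \<xi> (sum f A) = (\<Sum>x\<in>A. poly_eval \<xi> (f x))"
  by (induction A rule: infinite_finite_induct) (simp_all add: poly_eval_zero poly_eval_add)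

lemma poly_eval_single: "poly_eval \<xi> (Poly_Mapping.single m c) = c * monomial_eval \<xi> m"
  by (simp add: poly_eval_def monomial_eval_def)

lemma poly_mapping_eq_sum_single:
  "f = (\<Sum>m\<in>Poly_Mapping.keys f. Poly_Mapping.single m (Poly_Mapping.lookup f m))"
  by (rule poly_mapping_eqI) (simp add: lookup_sum lookup_single when_def in_keys_iff)

lemma poly_eval_mult: "poly_eval \<xi> (f * g) = poly_eval \<xi> f * poly_eval \<xi> g"
proof -
  let ?s = "\<lambda>f m. Poly_Mapping.single m (Poly_Mapping.lookup f m)"
  have "f * g = (\<Sum>m\<in>Poly_Mapping.keys f. ?s f m) * (\<Sum>m\<in>Poly_Mapping.keys g. ?s g m)"
    by (simp only: poly_mapping_eq_sum_single[symmetric])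
  also have "\<dots> = (\<Sum>m\<in>Poly_Mapping.keys f. \<Sum>m'\<in>Poly_Mapping.keys g. ?s f m * ?s g m')"
    by (rule sum_product)
  finally have eq: "f * g = (\<Sum>m\<in>Poly_Mapping.keys f. \<Sum>m'\<in>Poly_Mapping.keys g. ?s f m * ?s g m')" .
  have single: "poly_eval \<xi> (?s f m * ?s g m') = poly_eval \<xi> (?s f m) * poly_eval \<xi> (?s g m')" for m m'
    by (simp only: mult_single poly_eval_single monomial_eval_add mult_ac)
  have "poly_eval \<xi> (f * g) = (\<Sum>m\<in>Poly_Mapping.keys f. \<Sum>m'\<in>Poly_Mapping.keys g.
      poly_eval \<xi> (?s f m) * poly_eval \<xi> (?s g m'))"
    unfolding eq poly_eval_sum single ..
  also have "\<dots> = (\<Sum>m\<in>Poly_Mapping.keys f. poly_eval \<xi> (?s f m)) *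
      (\<Sum>m\<in>Poly_Mapping.keys g. poly_eval \<xi> (?s g m))"
    by (rule sum_product[symmetric])
  also have "\<dots> = poly_eval \<xi> f * poly_eval \<xi> g"
    by (simp only: poly_eval_sum[symmetric] poly_mapping_eq_sum_single[symmetric])
  finally show ?thesis .
qed

lemma poly_eval_diff: "poly_eval \<xi> (f - g) = poly_eval \<xi> f - poly_eval \<xi> g"
  using poly_eval_add[of \<xi> "f - g" g] by simp

lemma poly_eval_poly_var: "poly_eval \<xi> (poly_var x) = \<xi> x"
  by (simp add: poly_var_def poly_eval_single monomial_eval_single)

text \<open>With \<open>g = param_exp p\<close> this is the exponent of the parameter
  \<open>p\<close> in the image of a live monomial under the toric parametrization.\<close>

definition weighted_degree :: "('a \<Rightarrow> nat) \<Rightarrow> ('a \<Rightarrow>\<^sub>0 nat) \<Rightarrow> nat" where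
  "weighted_degree g m = (\<Sum>x\<in>Poly_Mapping.keys m. Poly_Mapping.lookup m x * g x)"

lemma weighted_degree_add: "weighted_degree g (m + m') = weighted_degree g m + weighted_degree g m'"
proof -
  let ?S = "Poly_Mapping.keys m \<union> Poly_Mapping.keys m'"
  have *: "weighted_degree g n = (\<Sum>x\<in>?S. Poly_Mapping.lookup n x * g x)"
    if "Poly_Mapping.keys n \<subseteq> ?S" for n
    unfolding weighted_degree_def using that
    by (intro sum.mono_neutral_left) (auto simp: not_in_keys_iff_lookup_eq_zero)
  show ?thesis
    using *[OF keys_add] *[of m] *[of m'] by (simp add: lookup_add algebra_simps sum.distrib)
qed

lemma weighted_degree_single: "weighted_degree g (Poly_Mapping.single x n) = n * g x"
  and weighted_degree_zero: "weighted_degree g 0 = 0"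
  by (simp_all add: weighted_degree_def)

lemma keys_add_nat: "Poly_Mapping.keys (m + m' :: 'a \<Rightarrow>\<^sub>0 nat) = Poly_Mapping.keys m \<union> Poly_Mapping.keys m'"
  by (auto simp: in_keys_iff lookup_add)

definition monomial_of_list :: "'a list \<Rightarrow> 'a \<Rightarrow>\<^sub>0 nat" where
  "monomial_of_list L = (\<Sum>x\<leftarrow>L. Poly_Mapping.single x 1)"

lemma monomial_of_list_simps:
  "monomial_of_list [] = 0" "monomial_of_list (x # L) = Poly_Mapping.single x 1 + monomial_of_list L"
  by (simp_all add: monomial_of_list_def)

lemma keys_monomial_of_list: "Poly_Mapping.keys (monomial_of_list L) = set L"
  by (induction L) (simp_all add: monomial_of_list_simps keys_add_nat)

lemma weighted_degree_monomial_of_list: "weighted_degree g (monomial_of_list L) = (\<Sum>x\<leftarrow>L. g x)"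
  by (induction L) (simp_all add: monomial_of_list_simps weighted_degree_add weighted_degree_single
      weighted_degree_zero del: One_nat_def)

lemma single_monomial_of_list: "Poly_Mapping.single (monomial_of_list L) 1 = (\<Prod>x\<leftarrow>L. poly_var x)"
proof (induction L)
  case (Cons x L)
  have "Poly_Mapping.single (monomial_of_list (x # L)) 1 =
      poly_var x * Poly_Mapping.single (monomial_of_list L) (1 :: complex)"
    by (simp only: monomial_of_list_simps poly_var_def mult_single mult_1)
  then show ?case using Cons by simp
qed (simp add: monomial_of_list_simps)

lemma monomial_of_list_exists: "\<exists>L. m = monomial_of_list L"
proof (induction m rule: update_induct)
  case const
  then show ?case by (intro exI[of _ "[]"]) (simp add: monomial_of_list_simps)
next
  case (update f a b)
  then obtain L where L: "f = monomial_of_list L" by blast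
  have "monomial_of_list (replicate n a @ L) = Poly_Mapping.single a n + f" for n
  proof (induction n)
    case (Suc n)
    have "Poly_Mapping.single a (Suc n) = Poly_Mapping.single a 1 + Poly_Mapping.single a n"
      by (simp flip: single_add)
    then show ?case using Suc by (simp add: monomial_of_list_simps add.assoc)
  qed (simp add: L)
  moreover have "Poly_Mapping.update a b f = Poly_Mapping.single a b + f"
    using update.hyps(1)
    by (intro poly_mapping_eqI) (auto simp: lookup_update lookup_add lookup_single when_def in_keys_iff)
  ultimately show ?case by metis
qed

lemma dead_monomial_in_trek_ideal:
  assumes "x \<in> Poly_Mapping.keys m" "\<not> has_trek E (Rep_moment_var x)"
  shows "Poly_Mapping.single m c \<in> trek_ideal E"
proof -
  obtain L where L: "m = monomial_of_list L" using monomial_of_list_exists by blast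
  then obtain A B where AB: "L = A @ x # B"
    using assms(1) by (metis keys_monomial_of_list split_list)
  have "Poly_Mapping.single m c = Poly_Mapping.single 0 c * Poly_Mapping.single m 1"
    by (simp only: mult_single add_0 mult_1_right)
  also have "\<dots> = (Poly_Mapping.single 0 c * (\<Prod>x\<leftarrow>A. poly_var x) * (\<Prod>x\<leftarrow>B. poly_var x)) * poly_var x"
    unfolding L AB single_monomial_of_list
    by (simp only: map_append list.map prod_list.append prod_list.Cons mult_ac)
  finally show ?thesis
    using trek_ideal_mult[OF no_trek_in_trek_ideal[OF assms(2)]] by simp
qed

text \<open>The toric parameters: diagonal second moments, diagonal third moments and edge weights.
  A pair that is not an edge receives exponent 0 in \<open>param_exp\<close>.\<close>

type_synonym 'v model_param = "'v + 'v + 'v \<times> 'v"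

context polytree_graph
begin

definition param_exp :: "'v model_param \<Rightarrow> 'v moment_var \<Rightarrow> nat" where
  "param_exp p x = (case p of
     Inl w \<Rightarrow> of_bool (var_top x = w \<and> length (Rep_moment_var x) = 2)
   | Inr (Inl w) \<Rightarrow> of_bool (var_top x = w \<and> length (Rep_moment_var x) = 3)
   | Inr (Inr (u, v)) \<Rightarrow> if (u, v) \<in> E then edge_count u v x else 0)"

text \<open>The degrees in the diagonal moments determine how many factors have a given order and
  top, and the degrees in the edge weights are the edge counts.\<close>

lemma monomials_congruent:
  assumes live: "\<forall>x\<in>Poly_Mapping.keys m. live x" "\<forall>x\<in>Poly_Mapping.keys m'. live x"
    and deg: "\<And>p. weighted_degree (param_exp p) m = weighted_degree (param_exp p) m'"
  shows "Poly_Mapping.single m 1 - Poly_Mapping.single m' 1 \<in> trek_ideal E"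
proof -
  let ?kind = "\<lambda>x. (var_top x, length (Rep_moment_var x))"
  obtain L L' where L: "m = monomial_of_list L" "m' = monomial_of_list L'"
    using monomial_of_list_exists by metis
  have deg: "(\<Sum>x\<leftarrow>L. param_exp p x) = (\<Sum>x\<leftarrow>L'. param_exp p x)" for p
    using deg by (simp add: L weighted_degree_monomial_of_list)
  have cnt: "count (mset (map ?kind M)) (w, n) = (\<Sum>x\<leftarrow>M. of_bool (var_top x = w \<and> length (Rep_moment_var x) = n))"
    for M w n by (induction M) auto
  have "count (mset (map ?kind L)) (w, n) = count (mset (map ?kind L')) (w, n)" for w n
  proof -
    consider "n = 2" | "n = 3" | "n \<notin> {2, 3}" by blast
    then show ?thesis
    proof cases
      case 1
      then show ?thesis unfolding cnt using deg[of "Inl w"] by (simp add: param_exp_def)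
    next
      case 2
      then show ?thesis unfolding cnt using deg[of "Inr (Inl w)"] by (simp add: param_exp_def)
    next
      case 3
      then have "length (Rep_moment_var x) \<noteq> n" for x :: "'v moment_var"
        using Rep_moment_var_props(2)[of x] by metis
      then show ?thesis unfolding cnt by simp
    qed
  qed
  then have "mset (map ?kind L) = mset (map ?kind L')"
    by (intro multiset_eqI) (simp only: split_paired_all)
  from mset_map_eq_imp_reordering[OF this]
  obtain M where M: "mset M = mset L'" "map ?kind M = map ?kind L" by blast
  have reorder: "(\<Sum>x\<leftarrow>M. g x) = (\<Sum>x\<leftarrow>L'. g x)" for g :: "'v moment_var \<Rightarrow> nat"
    using M(1) by (metis mset_map sum_mset_sum_list)
  have "(\<Prod>x\<leftarrow>M. poly_var x) = (\<Prod>x\<leftarrow>L'. poly_var x)"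
    using M(1) by (metis mset_map prod_mset_prod_list)
  moreover have "(\<Prod>x\<leftarrow>L. poly_var x) - (\<Prod>x\<leftarrow>M. poly_var x) \<in> trek_ideal E"
  proof (rule prod_list_poly_var_congruent)
    show "\<forall>x\<in>set L. live x" using live(1) by (simp add: L keys_monomial_of_list)
    show "\<forall>x\<in>set M. live x"
      using live(2) mset_eq_setD[OF M(1)] by (simp add: L keys_monomial_of_list)
    show "map ?kind L = map ?kind M" by (simp only: M(2))
    show "(\<Sum>x\<leftarrow>L. edge_count u v x) = (\<Sum>x\<leftarrow>M. edge_count u v x)" if "(u, v) \<in> E" for u v
      using deg[of "Inr (Inr (u, v))"] that reorder by (simp add: param_exp_def)
  qed
  ultimately show ?thesis by (simp only: L single_monomial_of_list)
qed

end

section \<open>The trek rule\<close>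

lemma moment_ideal_iff:
  "f \<in> moment_ideal E \<longleftrightarrow> (\<forall>S T. (S, T) \<in> moment_model E \<longrightarrow> poly_eval (moment_point S T) f = 0)"
  by (auto simp: moment_ideal_def)

definition error_weight :: "real^'v^'v \<Rightarrow> real^'v^'v^'v \<Rightarrow> nat \<Rightarrow> 'v \<Rightarrow> real" where
  "error_weight \<Omega>2 \<Omega>3 n v = (if n = 2 then \<Omega>2 $ v $ v else \<Omega>3 $ v $ v $ v)"

context polytree_graph
begin

definition crosses :: "'v \<Rightarrow> 'v \<Rightarrow> 'v \<times> 'v \<Rightarrow> bool" where
  "crosses w x e \<longleftrightarrow> w \<preceq> fst e \<and> snd e \<preceq> x"

text \<open>An entry of the inverse of \<open>mat 1 - \<Lambda>\<close>, as a product over all edges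
  with factor 1 off the path, so that no path has to be chosen.\<close>

definition path_weight :: "('v \<Rightarrow> 'v \<Rightarrow> 'a) \<Rightarrow> 'v \<Rightarrow> 'v \<Rightarrow> 'a::comm_semiring_1" where
  "path_weight l w x = (if w \<preceq> x then \<Prod>e\<in>E. if crosses w x e then l (fst e) (snd e) else 1 else 0)"

text \<open>Along a directed path the side of an edge changes at most once and never back; a
  crossing is the increment of this indicator, and increments add up.\<close>

lemma crosses_trans:
  assumes "w \<preceq> z" "z \<preceq> x" "e \<in> E"
  shows "crosses w x e \<longleftrightarrow> crosses w z e \<or> crosses z x e" "\<not> (crosses w z e \<and> crosses z x e)"
proof -
  obtain u v where e: "e = (u, v)" by (cases e)
  then have uv: "(u, v) \<in> E" using assms by simp
  have "w \<preceq> x" using assms by (meson rtrancl_trans)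
  note c = crosses_iff_side[OF uv assms(1)] crosses_iff_side[OF uv assms(2)] crosses_iff_side[OF uv this]
    side_mono[OF uv assms(1)] side_mono[OF uv assms(2)]
  show "crosses w x e \<longleftrightarrow> crosses w z e \<or> crosses z x e" "\<not> (crosses w z e \<and> crosses z x e)"
    using c unfolding crosses_def e fst_conv snd_conv by blast+
qed

lemma path_weight_trans:
  assumes "w \<preceq> z" "z \<preceq> x"
  shows "path_weight l w x = path_weight l w z * path_weight l z x"
proof -
  have "w \<preceq> x" using assms by (meson rtrancl_trans)
  moreover have "(if crosses w x e then l (fst e) (snd e) else 1) =
      (if crosses w z e then l (fst e) (snd e) else 1) * (if crosses z x e then l (fst e) (snd e) else 1)"
    if "e \<in> E" for e
    using crosses_trans[OF assms that] by auto
  then have "(\<Prod>e\<in>E. if crosses w x e then l (fst e) (snd e) else 1) =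
      (\<Prod>e\<in>E. if crosses w z e then l (fst e) (snd e) else 1) *
      (\<Prod>e\<in>E. if crosses z x e then l (fst e) (snd e) else 1)"
    unfolding prod.distrib[symmetric] by (rule prod.cong[OF refl])
  ultimately show ?thesis using assms by (simp add: path_weight_def)
qed

lemma path_weight_refl: "path_weight l w w = 1"
proof -
  have "\<not> crosses w w e" if "e \<in> E" for e
    using that not_reaches_parent[of "fst e" "snd e"] unfolding crosses_def
    by (metis prod.collapse rtrancl_trans)
  then show ?thesis by (simp add: path_weight_def)
qed

lemma path_weight_edge:
  assumes "(w, c) \<in> E"
  shows "path_weight l w c = l w c"
proof -
  have "crosses w c e \<longleftrightarrow> e = (w, c)" if e: "e \<in> E" for e
  proof
    obtain u v where uv: "e = (u, v)" "(u, v) \<in> E" using e by (cases e) simp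
    assume "crosses w c e"
    then have "w \<preceq> u" "v \<preceq> c" by (simp_all add: crosses_def uv)
    have "\<not> c \<preceq> u"
      using \<open>v \<preceq> c\<close> not_reaches_parent[OF uv(2)] by (meson rtrancl_trans)
    have "w = u"
    proof (rule ccontr)
      assume "w \<noteq> u"
      then obtain d where d: "(w, d) \<in> E" "d \<preceq> u" using \<open>w \<preceq> u\<close> reaches_cases by blast
      moreover have "u \<preceq> c" using uv(2) \<open>v \<preceq> c\<close> by (rule converse_rtrancl_into_rtrancl)
      ultimately have "d \<preceq> c" by (meson rtrancl_trans)
      then have "d = c" using child_unique[OF d(1) assms] by blast
      then show False using d \<open>\<not> c \<preceq> u\<close> by blast
    qed
    moreover from this have "v = c" using child_unique[OF _ assms] uv(2) \<open>v \<preceq> c\<close> by blast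
    ultimately show "e = (w, c)" using uv(1) by simp
  qed (simp add: crosses_def)
  then have "(\<Prod>e\<in>E. if crosses w c e then l (fst e) (snd e) else 1) =
      (\<Prod>e\<in>E. if e = (w, c) then l w c else 1)"
    by (intro prod.cong) auto
  then show ?thesis using assms by (simp add: path_weight_def r_into_rtrancl)
qed

text \<open>At most one child of \<open>w\<close> leads to \<open>x\<close>, so at most one summand
  is nonzero and powers pass through the sum. Exponent 1 inverts the matrix; exponents 2 and 3
  recover the errors from the diagonal moments.\<close>

lemma path_weight_step:
  assumes l: "\<And>u v. (u, v) \<notin> E \<Longrightarrow> l u v = 0" and k: "0 < k"
  shows "path_weight l w x ^ k = of_bool (w = x) + (\<Sum>c\<in>UNIV. l w c ^ k * path_weight l c x ^ k)"
proof -
  have zero: "l w c ^ k * path_weight l c x ^ k = 0" if "\<not> ((w, c) \<in> E \<and> c \<preceq> x)" for c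
    using that l k by (auto simp: path_weight_def zero_power)
  show ?thesis
  proof (cases "\<exists>c. (w, c) \<in> E \<and> c \<preceq> x")
    case True
    then obtain c where c: "(w, c) \<in> E" "c \<preceq> x" by blast
    have "l w d ^ k * path_weight l d x ^ k = 0" if "d \<noteq> c" for d
      using zero[of d] child_unique[OF c(1) _ c(2)] that by blast
    then have "(\<Sum>d\<in>UNIV. l w d ^ k * path_weight l d x ^ k) =
        (\<Sum>d\<in>UNIV. if d = c then l w c ^ k * path_weight l c x ^ k else 0)"
      by (intro sum.cong) auto
    also have "\<dots> = (path_weight l w c * path_weight l c x) ^ k"
      by (simp add: path_weight_edge[OF c(1)] power_mult_distrib)
    also have "\<dots> = path_weight l w x ^ k"
      using path_weight_trans[OF r_into_rtrancl[OF c(1)] c(2), of l] by simp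
    moreover have "w \<noteq> x" using c not_reaches_parent by blast
    ultimately show ?thesis by simp
  next
    case False
    then have "(\<Sum>c\<in>UNIV. l w c ^ k * path_weight l c x ^ k) = 0"
      using zero by (intro sum.neutral) blast
    moreover have "path_weight l w x ^ k = of_bool (w = x)"
    proof (cases "w = x")
      case True
      then show ?thesis by (simp add: path_weight_refl)
    next
      case neq: False
      then have "\<not> w \<preceq> x" using False reaches_cases by blast
      then show ?thesis using neq k by (simp add: path_weight_def zero_power)
    qed
    ultimately show ?thesis by simp
  qed
qed

lemma matrix_inv_edge_matrix:
  assumes "\<Lambda> \<in> edge_matrices E"
  shows "matrix_inv (mat 1 - \<Lambda>) = (\<chi> i j. path_weight (\<lambda>u v. \<Lambda> $ u $ v) i j)"
proof -
  let ?A = "mat 1 - \<Lambda>" and ?p = "path_weight (\<lambda>u v. \<Lambda> $ u $ v)"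
  let ?B = "\<chi> i j. ?p i j"
  have l: "\<And>u v. (u, v) \<notin> E \<Longrightarrow> \<Lambda> $ u $ v = 0" using assms by (simp add: edge_matrices_def)
  have "(?A ** ?B) $ i $ j = mat 1 $ i $ j" for i j
  proof -
    have "(?A ** ?B) $ i $ j = (\<Sum>k\<in>UNIV. (if i = k then ?p k j else 0) - \<Lambda> $ i $ k * ?p k j)"
      by (simp add: matrix_matrix_mult_def mat_def algebra_simps) (intro sum.cong; simp)
    also have "\<dots> = ?p i j - (\<Sum>k\<in>UNIV. \<Lambda> $ i $ k * ?p k j)"
      by (simp add: sum_subtractf)
    also have "\<dots> = mat 1 $ i $ j"
      using path_weight_step[of "\<lambda>u v. \<Lambda> $ u $ v" 1 i j] l by (simp add: mat_def)
    finally show ?thesis .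
  qed
  then have AB: "?A ** ?B = mat 1" by (simp add: vec_eq_iff)
  then have BA: "?B ** ?A = mat 1" by (simp add: matrix_left_right_inverse)
  \<comment> \<open>\<open>matrix_inv\<close> is a choice among two-sided inverses; since
    \<open>?B\<close> is one, associativity fixes the value.\<close>
  have "?A ** matrix_inv ?A = mat 1 \<and> matrix_inv ?A ** ?A = mat 1"
    unfolding matrix_inv_def by (rule someI[of _ ?B]) (use AB BA in simp)
  then have "matrix_inv ?A = matrix_inv ?A ** (?A ** ?B)" "matrix_inv ?A ** ?A ** ?B = ?B"
    using AB by simp_all
  then show ?thesis by (simp add: matrix_mul_assoc)
qed

section \<open>Factorization of a moment at its top\<close>

definition moment :: "(nat \<Rightarrow> 'v \<Rightarrow> real) \<Rightarrow> ('v \<Rightarrow> 'v \<Rightarrow> real) \<Rightarrow> 'v list \<Rightarrow> real" where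
  "moment \<omega> l xs = (\<Sum>v\<in>UNIV. \<omega> (length xs) v * (\<Prod>x\<leftarrow>xs. path_weight l v x))"

lemma moment_cong:
  assumes "mset xs = mset ys"
  shows "moment \<omega> l xs = moment \<omega> l ys"
proof -
  have "(\<Prod>x\<leftarrow>xs. f x) = (\<Prod>x\<leftarrow>ys. f x)" for f :: "'v \<Rightarrow> real"
    using arg_cong[OF assms, of "\<lambda>M. prod_mset (image_mset f M)"]
    by (simp only: mset_map[symmetric] prod_mset_prod_list)
  then show ?thesis
    unfolding moment_def mset_eq_length[OF assms] by (simp only:)
qed

text \<open>A vertex \<open>v\<close> that reaches all entries reaches \<open>w\<close> as well, so
  every path from \<open>v\<close> passes through \<open>w\<close>. Otherwise both sides vanish, the
  right one because \<open>xs\<close> is not empty.\<close>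

lemma prod_path_weight_factor:
  assumes "xs \<noteq> []" "is_top w xs"
  shows "(\<Prod>x\<leftarrow>xs. path_weight l v x) = path_weight l v w ^ length xs * (\<Prod>x\<leftarrow>xs. path_weight l w x)"
proof (cases "v \<preceq> w")
  case True
  have "(\<Prod>x\<leftarrow>ys. path_weight l v x) = path_weight l v w ^ length ys * (\<Prod>x\<leftarrow>ys. path_weight l w x)"
    if "set ys \<subseteq> set xs" for ys
    using that
  proof (induction ys)
    case (Cons y ys)
    then have "w \<preceq> y" using assms(2) unfolding is_top_def by auto
    then show ?case using Cons path_weight_trans[OF True, of y l] by (simp add: mult_ac)
  qed simp
  then show ?thesis by blast
next
  case False
  then obtain x where "x \<in> set xs" "\<not> v \<preceq> x" using is_top_greatest[OF assms] by blast
  then have "0 \<in> set (map (path_weight l v) xs)" by (force simp: path_weight_def)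
  then have "(\<Prod>x\<leftarrow>xs. path_weight l v x) = 0" by (induction xs) auto
  moreover have "path_weight l v w = 0" using False by (simp add: path_weight_def)
  ultimately show ?thesis using assms(1) by (simp add: power_0_left)
qed

text \<open>The sum on the right is the diagonal moment at \<open>w\<close> of order
  \<open>length xs\<close>; this is the monomial form of the trek rule.\<close>

lemma moment_factor:
  assumes "xs \<noteq> []" "is_top w xs"
  shows "moment \<omega> l xs =
    (\<Sum>v\<in>UNIV. \<omega> (length xs) v * path_weight l v w ^ length xs) * (\<Prod>x\<leftarrow>xs. path_weight l w x)"
  unfolding moment_def sum_distrib_right
  by (rule sum.cong[OF refl], subst prod_path_weight_factor[OF assms]) (simp only: mult.assoc)

lemma moment_eq_0:
  assumes "\<not> has_trek E xs"
  shows "moment \<omega> l xs = 0"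
proof -
  have "(\<Prod>x\<leftarrow>xs. path_weight l v x) = 0" for v
  proof -
    obtain x where "x \<in> set xs" "\<not> v \<preceq> x" using assms unfolding has_trek_iff by blast
    then have "0 \<in> set (map (path_weight l v) xs)" by (force simp: path_weight_def)
    then show ?thesis by (induction xs) auto
  qed
  then show ?thesis by (simp add: moment_def)
qed

text \<open>The paths from \<open>w\<close> to \<open>i\<close> and to \<open>j\<close> both pass
  through the top of \<open>i\<close> and \<open>j\<close>. Thus every column of the trek-matrix is
  a multiple of one vector that does not depend on the column, which is why the minors vanish on the
  model.\<close>

lemma moment_proportional:
  assumes "is_top w (i # c)" "is_top w (j # c)"
  shows "\<exists>K. \<forall>x\<in>{i, j}. moment \<omega> l (x # c) = K * path_weight l (trek_top E [i, j]) x"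
proof -
  have w: "w \<preceq> i" "w \<preceq> j" using assms by (simp_all add: is_top_def)
  then obtain u where u: "is_top u [i, j]" using is_top_exists[of "[i, j]" w] by auto
  then have tt: "trek_top E [i, j] = u" by (intro trek_top_eq) simp_all
  have "w \<preceq> u" by (rule is_top_greatest[OF _ u]) (use w in auto)
  let ?K = "(\<Sum>v\<in>UNIV. \<omega> (Suc (length c)) v * path_weight l v w ^ Suc (length c)) *
    path_weight l w u * (\<Prod>x\<leftarrow>c. path_weight l w x)"
  have "moment \<omega> l (x # c) = ?K * path_weight l u x" if x: "x \<in> {i, j}" for x
  proof -
    have top: "is_top w (x # c)" using x assms by blast
    have "\<forall>y\<in>set [i, j]. u \<preceq> y" using u unfolding is_top_def by blast
    then have "u \<preceq> x" using x by auto
    note trans = path_weight_trans[OF \<open>w \<preceq> u\<close> \<open>u \<preceq> x\<close>, of l]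
    show ?thesis
      unfolding moment_factor[OF list.distinct(2) top] list.map prod_list.Cons list.size trans
      by (simp only: add_Suc_right add_0_right mult_ac)
  qed
  then show ?thesis unfolding tt by blast
qed

lemma moment_point_eq_moment:
  assumes "diagonal \<Omega>2" "diagonal_tensor \<Omega>3" "\<Lambda> \<in> edge_matrices E"
    and B: "B = matrix_inv (mat 1 - \<Lambda>)"
  shows "moment_point (transpose B ** \<Omega>2 ** B) (tucker \<Omega>3 B B B) x =
    of_real (moment (error_weight \<Omega>2 \<Omega>3) (\<lambda>u v. \<Lambda> $ u $ v) (Rep_moment_var x))"
proof -
  let ?p = "path_weight (\<lambda>u v. \<Lambda> $ u $ v)"
  have B: "B $ i $ j = ?p i j" for i j
    using matrix_inv_edge_matrix[OF assms(3)] B by simp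
  have S: "(transpose B ** \<Omega>2 ** B) $ i $ j = (\<Sum>v\<in>UNIV. \<Omega>2 $ v $ v * (?p v i * ?p v j))" for i j
  proof -
    have row: "(transpose B ** \<Omega>2) $ i $ v = ?p v i * \<Omega>2 $ v $ v" for v
    proof -
      have "(transpose B ** \<Omega>2) $ i $ v = (\<Sum>u\<in>UNIV. ?p u i * \<Omega>2 $ u $ v)"
        by (simp add: matrix_matrix_mult_def transpose_def B)
      also have "\<dots> = (\<Sum>u\<in>UNIV. if u = v then ?p v i * \<Omega>2 $ v $ v else 0)"
        using assms(1) by (intro sum.cong) (auto simp: diagonal_def)
      finally show ?thesis by simp
    qed
    have "(transpose B ** \<Omega>2 ** B) $ i $ j = (\<Sum>v\<in>UNIV. (transpose B ** \<Omega>2) $ i $ v * B $ v $ j)"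
      by (simp only: matrix_matrix_mult_def[of "transpose B ** \<Omega>2" B] vec_lambda_beta)
    then show ?thesis unfolding row B by (simp only: mult_ac)
  qed
  have T: "tucker \<Omega>3 B B B $ i $ j $ k = (\<Sum>v\<in>UNIV. \<Omega>3 $ v $ v $ v * (?p v i * (?p v j * ?p v k)))" for i j k
  proof -
    have "tucker \<Omega>3 B B B $ i $ j $ k =
        (\<Sum>a\<in>UNIV. \<Sum>b\<in>UNIV. \<Sum>c\<in>UNIV. \<Omega>3 $ a $ b $ c * ?p a i * ?p b j * ?p c k)"
      by (simp add: tucker_def B)
    also have "\<dots> = (\<Sum>a\<in>UNIV. \<Sum>b\<in>UNIV. \<Sum>c\<in>UNIV.
        if c = a then if b = a then \<Omega>3 $ a $ a $ a * (?p a i * (?p a j * ?p a k)) else 0 else 0)"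
      using assms(2) by (intro sum.cong refl) (auto simp: diagonal_tensor_def)
    finally show ?thesis by simp
  qed
  consider i j where "Rep_moment_var x = [i, j]" | i j k where "Rep_moment_var x = [i, j, k]"
    using Rep_moment_var_props(2)[of x]
    by (auto simp: numeral_2_eq_2 numeral_3_eq_3 length_Suc_conv)
  then show ?thesis
    by cases (simp_all add: moment_point_def moment_def error_weight_def S T)
qed

lemma moment_point_in_model:
  assumes "(S, T) \<in> moment_model E"
  shows "\<exists>\<omega> l. \<forall>x. moment_point S T x = of_real (moment \<omega> l (Rep_moment_var x))"
proof -
  obtain \<Omega>2 \<Omega>3 \<Lambda> B where *: "S = transpose B ** \<Omega>2 ** B" "T = tucker \<Omega>3 B B B"
      "diagonal \<Omega>2" "diagonal_tensor \<Omega>3" "\<Lambda> \<in> edge_matrices E" "B = matrix_inv (mat 1 - \<Lambda>)"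
    using assms unfolding moment_model_def by blast
  show ?thesis
    unfolding *(1,2) using moment_point_eq_moment[OF *(3-6)] by blast
qed

lemma trek_ideal_subset_moment_ideal: "trek_ideal E \<subseteq> moment_ideal E"
proof -
  have "f \<in> moment_ideal E" if f: "f \<in> \<Union> {trek_minors E i j | i j. has_trek E [i, j]} \<union>
      {s_var i j | i j. \<not> has_trek E [i, j]} \<union> {t_var i j k | i j k. \<not> has_trek E [i, j, k]}" for f
    unfolding moment_ideal_iff
  proof (intro allI impI)
    fix S T assume "(S, T) \<in> moment_model E"
    then obtain \<omega> l where pt: "\<And>x. moment_point S T x = of_real (moment \<omega> l (Rep_moment_var x))"
      using moment_point_in_model by metis
    let ?ev = "poly_eval (moment_point S T)"
    have ev: "?ev (list_var xs) = of_real (moment \<omega> l xs)" if "length xs \<in> {2, 3}" for xs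
      using moment_cong[of "sort xs" xs]
      by (simp add: list_var_def poly_eval_poly_var pt Rep_moment_var_sort[OF that])
    consider i j where "f \<in> trek_minors E i j"
      | i j where "f = s_var i j" "\<not> has_trek E [i, j]"
      | i j k where "f = t_var i j k" "\<not> has_trek E [i, j, k]"
      using f by blast
    then show "?ev f = 0"
    proof cases
      case 1
      then obtain c d where cd: "c \<in> trek_cols E i j" "d \<in> trek_cols E i j"
          "f = det (\<chi> r. \<chi> q :: 2. trek_matrix i j r (if q = 1 then c else d))"
        unfolding trek_minors_def by blast
      have col: "\<exists>K. \<forall>r. ?ev (trek_matrix i j r q) = K *
          of_real (path_weight l (trek_top E [i, j]) (if r = 1 then i else j))"
        if q: "q \<in> trek_cols E i j" for q
      proof -
        obtain c where c: "same_top E i j c" "length c \<in> {1, 2}"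
            "\<And>r. trek_matrix i j r q = list_var ((if r = 1 then i else j) # c)"
        proof -
          consider k where "q = SCol k" "same_top E i j [k]"
            | a b where "q = TCol a b" "same_top E i j [a, b]"
            using q unfolding trek_cols_def by blast
          then show ?thesis
            by cases (rule that; simp add: trek_matrix_def s_var_eq t_var_eq)+
        qed
        obtain w where "is_top w (i # c)" "is_top w (j # c)"
          using c(1) unfolding same_top_iff by blast
        from moment_proportional[OF this, of \<omega> l] obtain K where
          K: "\<And>x. x \<in> {i, j} \<Longrightarrow> moment \<omega> l (x # c) = K * path_weight l (trek_top E [i, j]) x"
          by blast
        have "?ev (trek_matrix i j r q) = of_real K *
          of_real (path_weight l (trek_top E [i, j]) (if r = 1 then i else j))" for r
          using c(2) by (simp add: c(3) ev K)
        then show ?thesis by blast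
      qed
      obtain K K' where "\<And>r. ?ev (trek_matrix i j r c) = K *
          of_real (path_weight l (trek_top E [i, j]) (if r = 1 then i else j))"
        "\<And>r. ?ev (trek_matrix i j r d) = K' *
          of_real (path_weight l (trek_top E [i, j]) (if r = 1 then i else j))"
        using col[OF cd(1)] col[OF cd(2)] by metis
      then show ?thesis
        by (simp add: cd(3) det_2 poly_eval_diff poly_eval_mult)
    next
      case 2
      then show ?thesis by (simp add: s_var_eq ev moment_eq_0)
    next
      case 3
      then show ?thesis by (simp add: t_var_eq ev moment_eq_0)
    qed
  qed
  moreover have "ring_ideal.subspace (moment_ideal E)"
    unfolding ring_ideal.subspace_def Ball_def moment_ideal_iff
    by (simp add: poly_eval_zero poly_eval_add poly_eval_mult)
  ultimately show ?thesis
    unfolding trek_ideal_def ideal_generated_by_def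
    using ring_ideal.span_minimal[OF subsetI] by blast
qed

end

section \<open>A curve in the model that separates monomials\<close>

lemma base_expansion_unique:
  fixes c d :: "nat \<Rightarrow> nat"
  assumes "\<And>i. i < n \<Longrightarrow> c i < M" "\<And>i. i < n \<Longrightarrow> d i < M"
    and "(\<Sum>i<n. c i * M ^ i) = (\<Sum>i<n. d i * M ^ i)" "i < n"
  shows "c i = d i"
  using assms
proof (induction n arbitrary: i)
  case (Suc n)
  have bound: "(\<Sum>i<k. b i * M ^ i) < M ^ k" if "\<And>i. i < k \<Longrightarrow> b i < M" for b k
    using that
  proof (induction k)
    case (Suc k)
    then have "b k * M ^ k + (\<Sum>i<k. b i * M ^ i) < b k * M ^ k + M ^ k" by simp
    also have "\<dots> = (b k + 1) * M ^ k" by simp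
    also have "\<dots> \<le> M * M ^ k" using Suc.prems[of k] by (intro mult_le_mono1) simp
    finally show ?case by simp
  qed simp
  let ?c = "\<Sum>i<n. c i * M ^ i" and ?d = "\<Sum>i<n. d i * M ^ i"
  have "?c < M ^ n" "?d < M ^ n" using bound Suc.prems(1,2) by simp_all
  moreover have "(a + k * B) div B = k" if "a < B" for a k B :: nat
    using that by (intro div_nat_eqI) auto
  ultimately have "(?c + c n * M ^ n) div M ^ n = c n" "(?d + d n * M ^ n) div M ^ n = d n"
    by blast+
  moreover have eq: "?c + c n * M ^ n = ?d + d n * M ^ n" using Suc.prems(3) by simp
  ultimately have "c n = d n" by metis
  moreover from this have "?c = ?d" using eq by simp
  ultimately show ?case using Suc.IH[of i] Suc.prems by (cases "i = n") auto
qed simp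

lemma weighted_sum_unique:
  fixes c d :: "'a \<Rightarrow> nat"
  assumes "finite A" "inj_on h A" "\<And>p. p \<in> A \<Longrightarrow> c p < M" "\<And>p. p \<in> A \<Longrightarrow> d p < M" "0 < M"
    and eq: "(\<Sum>p\<in>A. c p * M ^ h p) = (\<Sum>p\<in>A. d p * M ^ h p)" and "p \<in> A"
  shows "c p = d p"
proof -
  obtain n where n: "h ` A \<subseteq> {..<n}"
    using finite_nat_bounded assms(1) by blast
  \<comment> \<open>Positions outside the image of \<open>h\<close> carry the digit 0, which is
    below \<open>M\<close> because \<open>0 < M\<close>.\<close>
  let ?digit = "\<lambda>c j. if j \<in> h ` A then c (the_inv_into A h j) else 0 :: nat"
  have inv: "the_inv_into A h (h q) = q" if "q \<in> A" for q
    using the_inv_into_f_f[OF assms(2) that] .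
  have digits: "(\<Sum>p\<in>A. b p * M ^ h p) = (\<Sum>j<n. ?digit b j * M ^ j)" for b :: "'a \<Rightarrow> nat"
  proof -
    have "(\<Sum>p\<in>A. b p * M ^ h p) = (\<Sum>j\<in>h ` A. ?digit b j * M ^ j)"
      using inv by (simp add: sum.reindex[OF assms(2)])
    also have "\<dots> = (\<Sum>j<n. ?digit b j * M ^ j)"
      using n by (intro sum.mono_neutral_left) auto
    finally show ?thesis .
  qed
  have "?digit c (h p) = ?digit d (h p)"
  proof (rule base_expansion_unique[of n "?digit c" M "?digit d"])
    show "?digit c i < M" "?digit d i < M" for i
      using assms(3-5) inv by auto
    show "(\<Sum>i<n. ?digit c i * M ^ i) = (\<Sum>i<n. ?digit d i * M ^ i)"
      using eq unfolding digits .
    show "h p < n" using n assms(7) by blast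
  qed
  then show ?thesis using assms(7) inv by simp
qed

lemma sum_UNIV_Plus:
  fixes f :: "'a::finite + 'b::finite \<Rightarrow> 'c::comm_monoid_add"
  shows "(\<Sum>p\<in>UNIV. f p) = (\<Sum>a\<in>UNIV. f (Inl a)) + (\<Sum>b\<in>UNIV. f (Inr b))"
  using sum.Plus[of "UNIV :: 'a set" "UNIV :: 'b set" f] by (simp add: comp_def)

text \<open>An interval of any positive length contains infinitely many points, so it is enough to
  control the curve for small parameters.\<close>

lemma sum_power_eq_0_imp_coeffs:
  fixes c :: "'a \<Rightarrow> complex"
  assumes "finite A" "0 < \<delta>" "\<And>x::real. 0 < x \<Longrightarrow> x < \<delta> \<Longrightarrow> (\<Sum>m\<in>A. c m * of_real x ^ d m) = 0"
  shows "(\<Sum>m\<in>{m\<in>A. d m = n}. c m) = 0"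
proof -
  define p where "p = (\<Sum>m\<in>A. monom (c m) (d m))"
  have "p = 0"
  proof (rule ccontr)
    assume "p \<noteq> 0"
    then have "finite {z. poly p z = 0}" by (rule poly_roots_finite)
    moreover have "of_real ` {0<..<\<delta>} \<subseteq> {z. poly p z = 0}"
      using assms(3) by (auto simp: p_def poly_sum poly_monom)
    ultimately have "finite (complex_of_real ` {0<..<\<delta>})" by (rule rev_finite_subset)
    then have "finite {0<..<\<delta>}" by (rule finite_imageD) (simp add: inj_on_def)
    then show False using infinite_Ioo[OF assms(2)] by blast
  qed
  then have "coeff p n = 0" by simp
  then show ?thesis
    by (simp add: p_def coeff_sum coeff_monom sum.If_cases[OF assms(1)] Int_def)
qed

lemma positive_definite_diagonal:
  fixes \<omega> :: "'n::finite \<Rightarrow> real"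
  assumes "\<And>v. 0 < \<omega> v"
  shows "positive_definite (\<chi> i j. if i = j then \<omega> i else 0)"
proof -
  let ?D = "\<chi> i j. if i = j then \<omega> i else 0"
  have "0 < y \<bullet> (?D *v y)" if "y \<noteq> 0" for y :: "real^'n"
  proof -
    have "y \<bullet> (?D *v y) = (\<Sum>i\<in>UNIV. \<omega> i * (y $ i)\<^sup>2)"
    proof -
      have mv: "(?D *v y) $ i = \<omega> i * y $ i" for i
      proof -
        have "(?D *v y) $ i = (\<Sum>j\<in>UNIV. if j = i then \<omega> i * y $ i else 0)"
          unfolding matrix_vector_mult_def vec_lambda_beta by (intro sum.cong) auto
        then show ?thesis by simp
      qed
      show ?thesis
        unfolding inner_vec_def mv by (intro sum.cong) (auto simp: power2_eq_square)
    qed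
    moreover obtain i where "y $ i \<noteq> 0" using \<open>y \<noteq> 0\<close> by (auto simp: vec_eq_iff)
    ultimately show ?thesis
      using assms sum_pos2[of UNIV i "\<lambda>i. \<omega> i * (y $ i)\<^sup>2"] by (simp add: less_imp_le)
  qed
  moreover have "transpose ?D = ?D" by (auto simp: transpose_def vec_eq_iff)
  ultimately show ?thesis by (simp add: positive_definite_def)
qed

section \<open>The curve and the orders of monomials along it\<close>

context polytree_graph
begin

text \<open>The bracket is the error that makes \<open>a\<close> the diagonal moments of order
  \<open>k\<close>: by \<open>path_weight_step\<close> the contributions of all vertices other than
  \<open>w\<close> cancel.\<close>

lemma sum_error_path_weight:
  assumes l: "\<And>u v. (u, v) \<notin> E \<Longrightarrow> l u v = (0::real)" and k: "0 < k"
  shows "(\<Sum>v\<in>UNIV. (a v - (\<Sum>p\<in>UNIV. l p v ^ k * a p)) * path_weight l v w ^ k) = a w"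
proof -
  let ?P = "\<lambda>v. path_weight l v w ^ k"
  have step: "(\<Sum>v\<in>UNIV. l p v ^ k * ?P v) = ?P p - of_bool (p = w)" for p
    using path_weight_step[of l k p w, OF l k] by simp
  have "(\<Sum>v\<in>UNIV. (a v - (\<Sum>p\<in>UNIV. l p v ^ k * a p)) * ?P v) =
      (\<Sum>v\<in>UNIV. a v * ?P v) - (\<Sum>v\<in>UNIV. \<Sum>p\<in>UNIV. a p * (l p v ^ k * ?P v))"
    unfolding left_diff_distrib sum_subtractf sum_distrib_right by (simp only: mult_ac)
  also have "(\<Sum>v\<in>UNIV. \<Sum>p\<in>UNIV. a p * (l p v ^ k * ?P v)) =
      (\<Sum>p\<in>UNIV. a p * (?P p - of_bool (p = w)))"
    by (subst sum.swap) (simp only: sum_distrib_left[symmetric] step)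
  also have "\<dots> = (\<Sum>p\<in>UNIV. a p * ?P p) - (\<Sum>p\<in>UNIV. if p = w then a w else 0)"
    unfolding sum_subtractf[symmetric] by (intro sum.cong) (auto simp: right_diff_distrib)
  finally show ?thesis by simp
qed

lemma prod_path_weight_power:
  fixes x :: real
  assumes l: "\<And>u v. (u, v) \<in> E \<Longrightarrow> l u v = x ^ W (u, v)" and "\<forall>y\<in>set ys. w \<preceq> y"
  shows "(\<Prod>y\<leftarrow>ys. path_weight l w y) = x ^ (\<Sum>e\<in>E. W e * length (filter (\<lambda>y. crosses w y e) ys))"
  using assms(2)
proof (induction ys)
  case (Cons y ys)
  have "w \<preceq> y" using Cons.prems by simp
  then have "path_weight l w y = (\<Prod>e\<in>E. if crosses w y e then l (fst e) (snd e) else 1)"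
    by (simp only: path_weight_def if_True)
  also have "\<dots> = (\<Prod>e\<in>E. x ^ (W e * of_bool (crosses w y e)))"
    using l by (intro prod.cong) auto
  also have "\<dots> = x ^ (\<Sum>e\<in>E. W e * of_bool (crosses w y e))"
    by (simp only: power_sum)
  finally have "path_weight l w y = x ^ (\<Sum>e\<in>E. W e * of_bool (crosses w y e))" .
  moreover have "(\<Sum>e\<in>E. W e * length (filter (\<lambda>y. crosses w y e) (y # ys))) =
      (\<Sum>e\<in>E. W e * of_bool (crosses w y e)) + (\<Sum>e\<in>E. W e * length (filter (\<lambda>y. crosses w y e) ys))"
    unfolding sum.distrib[symmetric] by (intro sum.cong) (auto simp: algebra_simps)
  ultimately show ?case using Cons by (simp add: power_add)
qed simp

text \<open>Splits the exponent as \<open>moment_factor\<close> splits a moment: one share for the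
  diagonal moment at the top, one for each edge.\<close>

lemma weight_exponent:
  assumes "live x"
  shows "(\<Sum>p\<in>UNIV. W p * param_exp p x) =
    (if length (Rep_moment_var x) = 2 then W (Inl (var_top x)) else W (Inr (Inl (var_top x)))) +
    (\<Sum>e\<in>E. W (Inr (Inr e)) * length (filter (\<lambda>y. crosses (var_top x) y e) (Rep_moment_var x)))"
proof -
  have edge: "(\<Sum>e\<in>UNIV. W (Inr (Inr e)) * param_exp (Inr (Inr e)) x) =
      (\<Sum>e\<in>E. W (Inr (Inr e)) * length (filter (\<lambda>y. crosses (var_top x) y e) (Rep_moment_var x)))"
  proof -
    have "param_exp (Inr (Inr e)) x =
        (if e \<in> E then length (filter (\<lambda>y. crosses (var_top x) y e) (Rep_moment_var x)) else 0)" for e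
      by (cases e) (simp add: param_exp_def edge_count_def crosses_def)
    then have "(\<Sum>e\<in>UNIV. W (Inr (Inr e)) * param_exp (Inr (Inr e)) x) = (\<Sum>e\<in>UNIV. if e \<in> E
        then W (Inr (Inr e)) * length (filter (\<lambda>y. crosses (var_top x) y e) (Rep_moment_var x)) else 0)"
      by (intro sum.cong) auto
    then show ?thesis by (simp add: sum.If_cases)
  qed
  have "(\<Sum>w\<in>UNIV. W (Inl w) * param_exp (Inl w) x) = (\<Sum>w\<in>UNIV. if w = var_top x
        then if length (Rep_moment_var x) = 2 then W (Inl (var_top x)) else 0 else 0)"
    by (intro sum.cong) (auto simp: param_exp_def)
  moreover have "(\<Sum>w\<in>UNIV. W (Inr (Inl w)) * param_exp (Inr (Inl w)) x) = (\<Sum>w\<in>UNIV. if w = var_top x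
        then if length (Rep_moment_var x) = 3 then W (Inr (Inl (var_top x))) else 0 else 0)"
    by (intro sum.cong) (auto simp: param_exp_def)
  ultimately have "(\<Sum>w\<in>UNIV. W (Inl w) * param_exp (Inl w) x) =
      (if length (Rep_moment_var x) = 2 then W (Inl (var_top x)) else 0)"
    "(\<Sum>w\<in>UNIV. W (Inr (Inl w)) * param_exp (Inr (Inl w)) x) =
      (if length (Rep_moment_var x) = 3 then W (Inr (Inl (var_top x))) else 0)"
    by simp_all
  then show ?thesis
    using Rep_moment_var_props(2)[of x] by (auto simp: sum_UNIV_Plus edge)
qed

text \<open>
  Prescribing the diagonal moments instead of the error variances leaves positivity of the latter to be
  checked. It holds for small \<open>x\<close> because the edge weights are of higher order than the variances.
\<close>

lemma curve_in_model:
  fixes x :: real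
  assumes x: "0 < x" "CARD('v) * x < 1"
    and W: "\<And>v. W (Inl v) < K" "\<And>e. K \<le> W (Inr (Inr e))"
  shows "\<exists>(S, T)\<in>moment_model E. \<forall>y. moment_point S T y =
    (if live y then of_real x ^ (\<Sum>p\<in>UNIV. W p * param_exp p y) else 0)"
proof -
  have "1 \<le> CARD('v)" by (simp add: Suc_leI)
  then have "x \<le> CARD('v) * x" using x(1) by simp
  then have x1: "x < 1" using x(2) by simp
  define l where "l = (\<lambda>u v. if (u, v) \<in> E then x ^ W (Inr (Inr (u, v))) else 0)"
  define a where "a = (\<lambda>(n::nat) v. if n = 2 then x ^ W (Inl v) else x ^ W (Inr (Inl v)))"
  define \<omega> where "\<omega> = (\<lambda>n v. a n v - (\<Sum>p\<in>UNIV. l p v ^ n * a n p))"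
  define \<Omega>2 :: "((real, 'v) vec, 'v) vec" where "\<Omega>2 = (\<chi> i j. if i = j then \<omega> 2 i else 0)"
  define \<Omega>3 :: "(((real, 'v) vec, 'v) vec, 'v) vec" where "\<Omega>3 = (\<chi> i j k. if i = j \<and> j = k then \<omega> 3 i else 0)"
  define \<Lambda> :: "((real, 'v) vec, 'v) vec" where "\<Lambda> = (\<chi> i j. l i j)"
  define B where "B = matrix_inv (mat 1 - \<Lambda>)"
  have l0: "(u, v) \<notin> E \<Longrightarrow> l u v = 0" for u v by (simp add: l_def)
  have pos: "0 < \<omega> 2 v" for v
  proof -
    \<comment> \<open>Each of the \<open>CARD('v)\<close> terms is at most \<open>x ^ K\<close>, so
      their sum is below \<open>x ^ (K - 1)\<close> because \<open>CARD('v) * x < 1\<close>. Since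
      \<open>W (Inl v) \<le> K - 1\<close>, this is at most the prescribed variance.\<close>
    have "l p v ^ 2 * a 2 p \<le> x ^ K" for p
    proof -
      have "0 \<le> l p v" "l p v \<le> x ^ K" "l p v \<le> 1"
        using x(1) x1 W(2) by (auto simp: l_def power_decreasing power_le_one)
      then have "l p v ^ 2 \<le> x ^ K * 1" unfolding power2_eq_square by (intro mult_mono) auto
      moreover have "0 \<le> a 2 p" "a 2 p \<le> 1" using x(1) x1 by (auto simp: a_def power_le_one)
      ultimately have "l p v ^ 2 * a 2 p \<le> (x ^ K * 1) * 1" using x(1) by (intro mult_mono) auto
      then show ?thesis by simp
    qed
    then have "(\<Sum>p\<in>UNIV. l p v ^ 2 * a 2 p) \<le> (\<Sum>p\<in>(UNIV :: 'v set). x ^ K)" by (intro sum_mono)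
    also have "\<dots> = (CARD('v) * x) * x ^ (K - 1)"
      using W(1)[of v] by (cases K) simp_all
    also have "\<dots> < 1 * x ^ (K - 1)" using x by (intro mult_strict_right_mono) auto
    also have "\<dots> \<le> x ^ W (Inl v)" using x(1) x1 W(1)[of v] by (simp add: power_decreasing)
    finally show ?thesis by (simp add: \<omega>_def a_def)
  qed
  have diag: "diagonal \<Omega>2" "diagonal_tensor \<Omega>3" "\<Lambda> \<in> edge_matrices E"
    by (auto simp: diagonal_def diagonal_tensor_def edge_matrices_def \<Omega>2_def \<Omega>3_def \<Lambda>_def l_def)
  have "positive_definite \<Omega>2" unfolding \<Omega>2_def using pos by (rule positive_definite_diagonal)
  moreover have "symmetric_tensor \<Omega>3" by (auto simp: symmetric_tensor_def \<Omega>3_def)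
  ultimately have mem: "(transpose B ** \<Omega>2 ** B, tucker \<Omega>3 B B B) \<in> moment_model E"
    unfolding moment_model_def using diag B_def by blast
  have "moment_point (transpose B ** \<Omega>2 ** B) (tucker \<Omega>3 B B B) y =
      (if live y then of_real x ^ (\<Sum>p\<in>UNIV. W p * param_exp p y) else 0)" for y
  proof -
    let ?ys = "Rep_moment_var y"
    have "moment_point (transpose B ** \<Omega>2 ** B) (tucker \<Omega>3 B B B) y =
        of_real (moment (error_weight \<Omega>2 \<Omega>3) (\<lambda>u v. \<Lambda> $ u $ v) ?ys)"
      by (rule moment_point_eq_moment[OF diag B_def])
    also have "(\<lambda>u v. \<Lambda> $ u $ v) = l" by (simp add: \<Lambda>_def)
    finally have mp: "moment_point (transpose B ** \<Omega>2 ** B) (tucker \<Omega>3 B B B) y =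
        of_real (moment (error_weight \<Omega>2 \<Omega>3) l ?ys)" .
    show ?thesis
    proof (cases "live y")
      case False
      then show ?thesis using mp by (simp add: moment_eq_0)
    next
      case True
      let ?n = "length ?ys" and ?w = "var_top y"
      have n: "?n = 2 \<or> ?n = 3" using Rep_moment_var_props(2)[of y] by simp
      have top: "is_top ?w ?ys" by (rule is_top_var_top[OF True])
      have "error_weight \<Omega>2 \<Omega>3 ?n v = \<omega> ?n v" for v
        using n by (auto simp: error_weight_def \<Omega>2_def \<Omega>3_def)
      then have "moment (error_weight \<Omega>2 \<Omega>3) l ?ys =
          (\<Sum>v\<in>UNIV. \<omega> ?n v * path_weight l v ?w ^ ?n) * (\<Prod>z\<leftarrow>?ys. path_weight l ?w z)"
        using moment_factor[OF Rep_moment_var_ne_Nil top] by simp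
      also have "(\<Sum>v\<in>UNIV. \<omega> ?n v * path_weight l v ?w ^ ?n) = a ?n ?w"
        unfolding \<omega>_def using n by (intro sum_error_path_weight l0) auto
      also have "(\<Prod>z\<leftarrow>?ys. path_weight l ?w z) =
          x ^ (\<Sum>e\<in>E. W (Inr (Inr e)) * length (filter (\<lambda>y. crosses ?w y e) ?ys))"
        using top by (intro prod_path_weight_power) (auto simp: l_def is_top_def)
      also have "a ?n ?w * \<dots> = x ^ (\<Sum>p\<in>UNIV. W p * param_exp p y)"
        unfolding weight_exponent[OF True] a_def by (simp add: power_add)
      finally show ?thesis using mp True by simp
    qed
  qed
  then show ?thesis using mem by blast
qed

lemma monomial_eval_curve:
  fixes z :: complex
  assumes "\<And>y. \<xi> y = (if live y then z ^ (\<Sum>p\<in>UNIV. W p * param_exp p y) else 0)"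
  shows "monomial_eval \<xi> m = (if \<forall>y\<in>Poly_Mapping.keys m. live y
    then z ^ (\<Sum>p\<in>UNIV. W p * weighted_degree (param_exp p) m) else 0)"
proof (cases "\<forall>y\<in>Poly_Mapping.keys m. live y")
  case True
  have "(\<Sum>p\<in>UNIV. W p * weighted_degree (param_exp p) m) =
      (\<Sum>y\<in>Poly_Mapping.keys m. (\<Sum>p\<in>UNIV. W p * param_exp p y) * Poly_Mapping.lookup m y)"
    unfolding weighted_degree_def sum_distrib_left sum_distrib_right
    by (subst sum.swap) (simp add: mult_ac)
  moreover have "monomial_eval \<xi> m =
      (\<Prod>y\<in>Poly_Mapping.keys m. z ^ ((\<Sum>p\<in>UNIV. W p * param_exp p y) * Poly_Mapping.lookup m y))"
    unfolding monomial_eval_def using True by (intro prod.cong) (auto simp: assms power_mult)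
  ultimately show ?thesis using True by (simp add: power_sum)
next
  case False
  then obtain y where y: "y \<in> Poly_Mapping.keys m" "\<not> live y" by blast
  then have "\<xi> y ^ Poly_Mapping.lookup m y = 0"
    by (simp add: assms in_keys_iff zero_power)
  then have "monomial_eval \<xi> m = 0"
    unfolding monomial_eval_def using y(1) by (intro prod_zero) auto
  then show ?thesis by (simp only: False if_False)
qed

text \<open>Numbering the second moments first makes all their weights smaller than those of the
  edges, as positivity of the error variances along the curve requires.\<close>

lemma injective_numbering:
  "\<exists>h :: 'v model_param \<Rightarrow> nat. inj h \<and> (\<forall>v. h (Inl v) < CARD('v)) \<and> (\<forall>q. CARD('v) \<le> h (Inr q))"
proof -
  obtain f :: "'v \<Rightarrow> nat" where f: "bij_betw f UNIV {0..<CARD('v)}"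
    using ex_bij_betw_finite_nat[of "UNIV :: 'v set"] by auto
  obtain g :: "'v + 'v \<times> 'v \<Rightarrow> nat" where g: "inj g"
    using finite_imp_inj_to_nat_seg[of "UNIV :: ('v + 'v \<times> 'v) set"] by auto
  have f': "inj f" "f v < CARD('v)" for v
    using f bij_betwE[OF f] by (auto simp: bij_betw_def)
  let ?h = "case_sum f (\<lambda>q. CARD('v) + g q)"
  have "inj ?h"
  proof (rule injI)
    fix p q assume "?h p = ?h q"
    then show "p = q"
      using f'(2) injD[OF f'(1)] injD[OF g]
      by (cases p; cases q) (auto dest: sym, (metis add_lessD1 less_irrefl)+)
  qed
  then show ?thesis using f'(2) by (intro exI[of _ ?h]) simp
qed

lemma moment_ideal_subset_trek_ideal: "moment_ideal E \<subseteq> trek_ideal E"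
proof
  fix f assume f: "f \<in> moment_ideal E"
  let ?c = "Poly_Mapping.lookup f"
  define A where "A = {m\<in>Poly_Mapping.keys f. \<forall>y\<in>Poly_Mapping.keys m. live y}"
  have finA: "finite A" by (simp add: A_def)
  obtain h :: "'v model_param \<Rightarrow> nat" where h: "inj h" "\<And>v. h (Inl v) < CARD('v)" "\<And>q. CARD('v) \<le> h (Inr q)"
    using injective_numbering by blast
  \<comment> \<open>Exponents are powers of a base exceeding all degrees, so the order of a monomial along the curve determines all its degrees.\<close>
  define M where "M = 2 + (\<Sum>m\<in>A. \<Sum>p\<in>UNIV. weighted_degree (param_exp p) m)"
  define W where "W = (\<lambda>p. M ^ h p)"
  define d where "d = (\<lambda>m. \<Sum>p\<in>UNIV. W p * weighted_degree (param_exp p) m)"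
  have deg_less: "weighted_degree (param_exp p) m < M" if "m \<in> A" for m p
  proof -
    have "weighted_degree (param_exp p) m \<le> (\<Sum>p\<in>UNIV. weighted_degree (param_exp p) m)"
      by (rule member_le_sum) auto
    also have "\<dots> \<le> (\<Sum>m\<in>A. \<Sum>p\<in>UNIV. weighted_degree (param_exp p) m)"
      by (rule member_le_sum) (use that finA in auto)
    finally show ?thesis by (simp add: M_def)
  qed
  have cong: "Poly_Mapping.single m 1 - Poly_Mapping.single m' 1 \<in> trek_ideal E"
    if "m \<in> A" "m' \<in> A" "d m = d m'" for m m'
  proof (rule monomials_congruent)
    show "\<forall>y\<in>Poly_Mapping.keys m. live y" "\<forall>y\<in>Poly_Mapping.keys m'. live y"
      using that by (auto simp: A_def)
    show "weighted_degree (param_exp p) m = weighted_degree (param_exp p) m'" for p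
      using that deg_less h(1) unfolding d_def W_def
      by (intro weighted_sum_unique[of UNIV h "\<lambda>p. weighted_degree (param_exp p) m" M
            "\<lambda>p. weighted_degree (param_exp p) m'" p]) (auto simp: mult.commute M_def)
  qed
  have coeffs: "(\<Sum>m\<in>{m\<in>A. d m = n}. ?c m) = 0" for n
  proof (rule sum_power_eq_0_imp_coeffs[OF finA])
    \<comment> \<open>The parameter range in which the curve is known to stay in the model.\<close>
    show "0 < 1 / real CARD('v)" by simp
    fix x :: real assume x: "0 < x" "x < 1 / real CARD('v)"
    have "CARD('v) * x < 1" using x(2) by (simp add: field_simps)
    \<comment> \<open>\<open>M\<close> is at least 2, so its powers are ordered strictly by their
      exponents; the threshold \<open>M ^ CARD('v)\<close> separates the two kinds of
      weights.\<close>
    moreover have "W (Inl v) < M ^ CARD('v)" "M ^ CARD('v) \<le> W (Inr (Inr e))" for v e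
      using h by (auto simp: W_def M_def intro!: power_strict_increasing power_increasing)
    ultimately obtain S T where ST: "(S, T) \<in> moment_model E"
        "\<And>y. moment_point S T y = (if live y then of_real x ^ (\<Sum>p\<in>UNIV. W p * param_exp p y) else 0)"
      using curve_in_model[OF x(1), of W "M ^ CARD('v)"] by blast
    have "0 = poly_eval (moment_point S T) f" using f ST(1) by (simp add: moment_ideal_iff)
    also have "\<dots> = (\<Sum>m\<in>Poly_Mapping.keys f. ?c m * monomial_eval (moment_point S T) m)"
      by (rule poly_eval_superset) auto
    also have "\<dots> = (\<Sum>m\<in>Poly_Mapping.keys f. if m \<in> A then ?c m * of_real x ^ d m else 0)"
      unfolding monomial_eval_curve[OF ST(2)] d_def by (intro sum.cong) (auto simp: A_def)
    also have "\<dots> = (\<Sum>m\<in>A. ?c m * of_real x ^ d m)"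
      by (simp add: sum.If_cases A_def Int_def conj_ac)
    finally show "(\<Sum>m\<in>A. ?c m * of_real x ^ d m) = 0" by simp
  qed
  \<comment> \<open>One representative for each order along the curve. Moving every live monomial to
    its representative changes \<open>f\<close> only within the ideal, and the coefficients
    collected at each representative sum to 0.\<close>
  define rep where "rep = (\<lambda>n. SOME m. m \<in> A \<and> d m = n)"
  have rep: "rep (d m) \<in> A" "d (rep (d m)) = d m" if "m \<in> A" for m
    using someI[of "\<lambda>m'. m' \<in> A \<and> d m' = d m" m] that by (auto simp: rep_def)
  have single_sum: "(\<Sum>m\<in>X. Poly_Mapping.single k (g m)) = Poly_Mapping.single k (\<Sum>m\<in>X. g m)"
    for X and k :: "'v moment_var \<Rightarrow>\<^sub>0 nat" and g :: "_ \<Rightarrow> complex"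
    by (induction X rule: infinite_finite_induct) (simp_all add: single_add)
  have "(\<Sum>m\<in>A. Poly_Mapping.single (rep (d m)) (?c m)) =
      (\<Sum>n\<in>d ` A. \<Sum>m\<in>{m\<in>A. d m = n}. Poly_Mapping.single (rep (d m)) (?c m))"
    by (rule sum.image_gen[OF finA])
  also have "\<dots> = (\<Sum>n\<in>d ` A. Poly_Mapping.single (rep n) (\<Sum>m\<in>{m\<in>A. d m = n}. ?c m))"
    unfolding single_sum[symmetric] by (intro sum.cong) auto
  finally have zero: "(\<Sum>m\<in>A. Poly_Mapping.single (rep (d m)) (?c m)) = 0"
    by (simp add: coeffs)
  have live_part: "(\<Sum>m\<in>A. Poly_Mapping.single m (?c m) - Poly_Mapping.single (rep (d m)) (?c m)) \<in> trek_ideal E"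
  proof (rule trek_ideal_sum)
    fix m assume m: "m \<in> A"
    have "Poly_Mapping.single m (?c m) - Poly_Mapping.single (rep (d m)) (?c m) =
        Poly_Mapping.single 0 (?c m) * (Poly_Mapping.single m 1 - Poly_Mapping.single (rep (d m)) 1)"
      by (simp only: right_diff_distrib mult_single add_0 mult_1_right)
    then show "Poly_Mapping.single m (?c m) - Poly_Mapping.single (rep (d m)) (?c m) \<in> trek_ideal E"
      using trek_ideal_mult[OF cong[OF m rep(1)[OF m] rep(2)[OF m, symmetric]]] by simp
  qed
  have dead_part: "(\<Sum>m\<in>Poly_Mapping.keys f - A. Poly_Mapping.single m (?c m)) \<in> trek_ideal E"
    by (rule trek_ideal_sum) (auto simp: A_def intro: dead_monomial_in_trek_ideal)
  have "f = (\<Sum>m\<in>Poly_Mapping.keys f. Poly_Mapping.single m (?c m))"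
    by (rule poly_mapping_eq_sum_single)
  also have "\<dots> = (\<Sum>m\<in>Poly_Mapping.keys f - A. Poly_Mapping.single m (?c m)) +
      (\<Sum>m\<in>A. Poly_Mapping.single m (?c m))"
    by (rule sum.subset_diff) (auto simp: A_def)
  finally show "f \<in> trek_ideal E"
    using trek_ideal_add[OF dead_part live_part] by (simp add: sum_subtractf zero)
qed

end

theorem theorem4p10:
  fixes E :: "('v::{finite,linorder} \<times> 'v) set"
  assumes "polytree E"
  shows "moment_ideal E = trek_ideal E"
proof -
  interpret polytree_graph E by (rule polytree_graph.intro[OF assms])
  show ?thesis
    using moment_ideal_subset_trek_ideal trek_ideal_subset_moment_ideal by (rule equalityI)
qed

end
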